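(* In the setting described in the context (where the restriction of $b$ to $B_1$ is a transposition and $d$ is even), $\rho(G(a,b))=\max\{1,\tfrac{6}{d}\}$. In particular, if $d\leq 6$, then $\rho(G(a,b))\in\{1,\tfrac32,3\}$.
   Context: Let $p\geq5$ be a prime and $G\leq\mathrm{Sym}(\Omega)$ transitive with $|\Omega|=3p$, whose only non-trivial $G$-invariant partition is $\mathcal{B}=\{B_1,\dots,B_p\}$, $B_i=\{x_i,y_i,z_i\}$. Let $\overline{G}\leq\mathrm{Sym}(\mathcal{B})$ be the induced group and $K=\ker(G\to\overline{G})$. Assume $K\neq1$, $K$ contains no derangement (every element of $K$ fixes a point), every minimal normal subgroup of $G$ contained in $K$ is an elementary abelian $3$-group, and $K$ contains no involution. Assume $\overline{G}$ is solvable and non-cyclic: $\overline{G}=\langle\alpha\rangle\rtimes\langle\beta\rangle\leq\mathrm{AGL}(1,p)$ with $\alpha=(B_1\,B_2\,\cdots\,B_p)$, $o(\beta)=d$ even, $d\mid p-1$, $\beta$ fixing $B_1$, $\beta\alpha\beta^{-1}=\alpha^t$ with $\gcd(t,p)=1$. Let $a=(x_1\,\cdots\,x_p)(y_1\,\cdots\,y_p)(z_1\,\cdots\,z_p)\in G$ (with image $\alpha$) and $b\in G$ with image $\beta$, and assume the restriction of $b$ to $B_1$ is a transposition. Let $G(a,b)=\langle K,a,b\rangle$. For a transitive group $H\leq\mathrm{Sym}(\Omega)$, $\rho(H)=\max\{|\mathcal{F}|:\mathcal{F}\subseteq H\text{ intersecting}\}/|H_\omega|$, where $\mathcal{F}$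 is intersecting if any two of its elements agree on some point of $\Omega$. *)

theory Defs
  imports
    "HOL-Algebra.Elementary_Groups"
    "HOL-Algebra.Group_Action"
    "HOL-Algebra.Multiplicative_Group"
    "HOL-Algebra.Solvable_Groups"
    "HOL-Combinatorics.Transposition"
    "HOL-Computational_Algebra.Primes"
    "HOL-Library.Disjoint_Sets"
begin

text \<open>
  \<^const>\<open>BijGroup\<close> \<open>\<Omega>\<close> is the symmetric group on \<open>\<Omega>\<close>; its elements are extensional functions, and its
  product is composition with the right factor applied first.
\<close>

abbreviation perm_group :: "'a set \<Rightarrow> ('a \<Rightarrow> 'a) set \<Rightarrow> ('a \<Rightarrow> 'a) monoid" where
  "perm_group \<Omega> G \<equiv> (BijGroup \<Omega>)\<lparr>carrier := G\<rparr>"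

definition transitive_perm_group :: "'a set \<Rightarrow> ('a \<Rightarrow> 'a) set \<Rightarrow> bool" where
  "transitive_perm_group \<Omega> G \<longleftrightarrow>
     subgroup G (BijGroup \<Omega>) \<and> transitive_action (perm_group \<Omega> G) \<Omega> (\<lambda>g. g)"

definition invariant_partition :: "'a set \<Rightarrow> ('a \<Rightarrow> 'a) set \<Rightarrow> 'a set set \<Rightarrow> bool" where
  "invariant_partition \<Omega> G P \<longleftrightarrow> partition_on \<Omega> P \<and> (\<forall>g\<in>G. \<forall>S\<in>P. g ` S \<in> P)"

definition nontrivial_partition :: "'a set \<Rightarrow> 'a set set \<Rightarrow> bool" where
  "nontrivial_partition \<Omega> P \<longleftrightarrow> P \<noteq> {\<Omega>} \<and> P \<noteq> (\<lambda>\<omega>. {\<omega>}) ` \<Omega>"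

definition induced_perm :: "'a set set \<Rightarrow> ('a \<Rightarrow> 'a) \<Rightarrow> 'a set \<Rightarrow> 'a set" where
  "induced_perm \<B> g = (\<lambda>S\<in>\<B>. g ` S)"

definition derangement :: "'a set \<Rightarrow> ('a \<Rightarrow> 'a) \<Rightarrow> bool" where
  "derangement \<Omega> g \<longleftrightarrow> (\<forall>\<omega>\<in>\<Omega>. g \<omega> \<noteq> \<omega>)"

definition minimal_normal :: "'g set \<Rightarrow> ('g, 'm) monoid_scheme \<Rightarrow> bool" where
  "minimal_normal N G \<longleftrightarrow>
     N \<lhd> G \<and> N \<noteq> {\<one>\<^bsub>G\<^esub>} \<and> (\<forall>M. M \<lhd> G \<and> M \<subseteq> N \<longrightarrow> M = {\<one>\<^bsub>G\<^esub>} \<or> M = N)"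

definition elementary_abelian :: "nat \<Rightarrow> ('g, 'm) monoid_scheme \<Rightarrow> bool" where
  "elementary_abelian q G \<longleftrightarrow>
     prime q \<and> comm_group G \<and> (\<forall>x\<in>carrier G. x [^]\<^bsub>G\<^esub> q = \<one>\<^bsub>G\<^esub>)"

text \<open>\<open>G\<close> is the internal semidirect product of the normal subgroup \<open>N\<close> and the complement \<open>H\<close>.\<close>

definition semidirect :: "('g, 'm) monoid_scheme \<Rightarrow> 'g set \<Rightarrow> 'g set \<Rightarrow> bool" where
  "semidirect G N H \<longleftrightarrow>
     N \<lhd> G \<and> subgroup H G \<and> N \<inter> H = {\<one>\<^bsub>G\<^esub>} \<and> N <#>\<^bsub>G\<^esub> H = carrier G"

text \<open>
  \<open>AGL(1,p)\<close> acting on \<open>{B 1, \<dots>, B p}\<close>, where \<open>B i\<close> is identified with the residue of \<open>i\<close> modulo \<open>p\<close>.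
\<close>

definition AGL1 :: "nat \<Rightarrow> (nat \<Rightarrow> 'b) \<Rightarrow> ('b \<Rightarrow> 'b) set" where
  "AGL1 p B = {f \<in> carrier (BijGroup (B ` {1..p})).
     \<exists>c e. coprime c p \<and> (\<forall>i\<in>{1..p}. \<forall>j\<in>{1..p}. j mod p = (c * i + e) mod p \<longrightarrow> f (B i) = B j)}"

definition restricts_to_transposition :: "('a \<Rightarrow> 'a) \<Rightarrow> 'a set \<Rightarrow> bool" where
  "restricts_to_transposition g S \<longleftrightarrow>
     (\<exists>u\<in>S. \<exists>v\<in>S. u \<noteq> v \<and> (\<forall>w\<in>S. g w = transpose u v w))"

definition intersecting :: "'a set \<Rightarrow> ('a \<Rightarrow> 'a) set \<Rightarrow> bool" where
  "intersecting \<Omega> F \<longleftrightarrow> (\<forall>f\<in>F. \<forall>g\<in>F. \<exists>\<omega>\<in>\<Omega>. f \<omega> = g \<omega>)"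

text \<open>
  The density of \<open>H\<close>, computed with the stabilizer of the point \<open>\<omega>\<close>. For transitive \<open>H\<close> all point
  stabilizers are conjugate, so the value does not depend on \<open>\<omega> \<in> \<Omega>\<close>.
\<close>

definition intersection_density :: "'a set \<Rightarrow> ('a \<Rightarrow> 'a) set \<Rightarrow> 'a \<Rightarrow> real" where
  "intersection_density \<Omega> H \<omega> =
     real (Max {card F | F. F \<subseteq> H \<and> intersecting \<Omega> F})
       / real (card (stabilizer (perm_group \<Omega> H) (\<lambda>g. g) \<omega>))"

end

theory Submission
  imports Defs
begin

text \<open>
  Since \<open>K\<close> has no involution, it acts on every block through \<open>A\<^sub>3\<close>, so an element of \<open>K\<close> fixing one
  point of a block fixes the block pointwise. Let \<open>N\<close> be the preimage of \<open>\<langle>\<alpha>\<rangle>\<close> in \<open>G\<close>. Every element of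
  \<open>G\<close> has the form \<open>n b\<^sup>j\<close> with \<open>n \<in> N\<close> and a well-defined exponent \<open>j\<close> modulo \<open>d\<close>. Because \<open>b\<close> acts on
  its fixed block as a transposition, an element of even exponent that fixes a point fixes a block
  pointwise, while every element of \<open>b K\<close> has a fixed point.

  Let \<open>F\<close> be an intersecting family of elements of even exponent. Two of its members with the same
  exponent lie in the same coset of \<open>K\<close>. Elements of \<open>G\<close> outside \<open>K\<close> fix at most one block, so if \<open>F\<close>
  meets two cosets of \<open>K\<close>, the members of \<open>F\<close> in one coset all agree with a member of another coset
  on a common block. They then lie in a coset of a point stabilizer of \<open>K\<close> and number at most \<open>\<bar>K\<bar>/3\<close>.
  There are \<open>d/2\<close> even exponents, so \<open>\<bar>F\<bar> \<le> max \<bar>K\<bar> (d\<bar>K\<bar>/6)\<close>. Odd exponents reduce to even ones by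
  translating with \<open>b\<close>, and twice this bound is attained by \<open>K \<union> b K\<close> or by a point stabilizer
  of \<open>G\<close>, whose order is \<open>d\<bar>K\<bar>/3\<close>.
\<close>

section \<open>Symmetric groups, cycles and affine maps\<close>

lemma BijGroup_mult_apply:
  "f \<in> carrier (BijGroup S) \<Longrightarrow> g \<in> carrier (BijGroup S) \<Longrightarrow> s \<in> S \<Longrightarrow>
     (f \<otimes>\<^bsub>BijGroup S\<^esub> g) s = f (g s)"
  by (simp add: BijGroup_def compose_def)

lemma BijGroup_eqI:
  "f \<in> carrier (BijGroup S) \<Longrightarrow> g \<in> carrier (BijGroup S) \<Longrightarrow> (\<And>s. s \<in> S \<Longrightarrow> f s = g s) \<Longrightarrow> f = g"
  unfolding BijGroup_def by (metis Bij_imp_extensional extensionalityI partial_object.select_convs(1))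

lemma BijGroup_apply_closed: "f \<in> carrier (BijGroup S) \<Longrightarrow> s \<in> S \<Longrightarrow> f s \<in> S"
  using Bij_imp_funcset[of f S] by (auto simp: BijGroup_def)

lemma finite_BijGroup:
  assumes "finite S"
  shows "finite (carrier (BijGroup S))"
proof (rule finite_subset)
  show "carrier (BijGroup S) \<subseteq> S \<rightarrow>\<^sub>E S"
    by (auto simp: BijGroup_def PiE_def Bij_imp_extensional dest: Bij_imp_funcset)
  show "finite (S \<rightarrow>\<^sub>E S)"
    using assms by (simp add: finite_PiE)
qed

lemma (in group) generate_singleton_commute:
  assumes "g \<in> carrier G" "u \<in> generate G {g}" "v \<in> generate G {g}"
  shows "u \<otimes> v = v \<otimes> u"
proof -
  obtain i j :: int where "u = g [^] i" "v = g [^] j"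
    using assms generate_pow by auto
  then show ?thesis
    using assms(1) by (simp add: int_pow_mult[symmetric] add.commute)
qed

lemma cycle_pow_apply:
  fixes p :: nat
  assumes \<alpha>: "\<alpha> \<in> carrier (BijGroup (B ` {1..p}))"
    and cycle: "\<And>i. i \<in> {1..p} \<Longrightarrow> \<alpha> (B i) = B (i mod p + 1)"
    and n: "n < p"
  shows "(\<alpha> [^]\<^bsub>BijGroup (B ` {1..p})\<^esub> n) (B 1) = B (n + 1)"
  using n
proof (induction n)
  case 0
  then show ?case
    by (simp add: BijGroup_def)
next
  case (Suc n)
  interpret group "BijGroup (B ` {1..p})"
    by (rule group_BijGroup)
  have "\<alpha> [^]\<^bsub>BijGroup (B ` {1..p})\<^esub> Suc n
      = \<alpha> \<otimes>\<^bsub>BijGroup (B ` {1..p})\<^esub> \<alpha> [^]\<^bsub>BijGroup (B ` {1..p})\<^esub> n"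
    using nat_pow_Suc2[OF \<alpha>] .
  \<comment> \<open>Here \<open>Suc n < p\<close>, so \<open>(n + 1) mod p = n + 1\<close> and the
    cycle does not wrap around.\<close>
  then show ?case
    using Suc cycle[of "n + 1"] BijGroup_mult_apply[OF \<alpha> nat_pow_closed[OF \<alpha>], of "B 1" n] by simp
qed

text \<open>Subtracting the congruences c i + e = i and c j + e = j modulo p gives p | (c - 1)(i -
  j). As 0 < |i - j| < p, this forces c = 1 modulo p, hence e = 0 modulo p, and the affine map is
  the identity.\<close>

lemma AGL1_two_fixed:
  assumes f: "f \<in> AGL1 p B" and inj: "inj_on B {1..p}" and p: "prime p"
    and i: "i \<in> {1..p}" "f (B i) = B i" and j: "j \<in> {1..p}" "f (B j) = B j" and ij: "i \<noteq> j"
    and k: "k \<in> {1..p}"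
  shows "f (B k) = B k"
proof -
  obtain c e where ce: "\<And>l m. l \<in> {1..p} \<Longrightarrow> m \<in> {1..p} \<Longrightarrow> m mod p = (c * l + e) mod p \<Longrightarrow> f (B l) = B m"
    using f unfolding AGL1_def by blast
  have fixed: "int p dvd int c * int l + int e - int l" if l: "l \<in> {1..p}" "f (B l) = B l" for l
  proof -
    \<comment> \<open>Blocks are numbered from 1, so the residue 0 is represented by p.\<close>
    define m where "m = (if (c * l + e) mod p = 0 then p else (c * l + e) mod p)"
    have m: "m \<in> {1..p}" "m mod p = (c * l + e) mod p"
      using prime_gt_0_nat[OF p] by (auto simp: m_def less_imp_le)
    then have "B m = B l"
      using ce[OF l(1) m] l(2) by simp
    then have "m = l"
      by (rule inj_onD[OF inj _ m(1) l(1)])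
    then have "int (c * l + e) mod int p = int l mod int p"
      using m(2) by (metis zmod_int)
    then have "int p dvd int (c * l + e) - int l"
      by (rule mod_eq_dvd_iff[THEN iffD1])
    then show ?thesis
      by simp
  qed
  have "int p dvd (int c - 1) * (int i - int j)"
    using dvd_diff[OF fixed[OF i] fixed[OF j]] by (simp add: algebra_simps)
  then have "int p dvd int c - 1 \<or> int p dvd int i - int j"
    using p by (simp add: prime_dvd_mult_iff)
  moreover have "\<not> int p dvd int i - int j"
  proof
    assume "int p dvd int i - int j"
    then have "int p \<le> \<bar>int i - int j\<bar>"
      using ij zdvd_imp_le[of "int p" "\<bar>int i - int j\<bar>"] by simp
    then show False
      using i(1) j(1) by auto
  qed
  ultimately have "int p dvd int c - 1"
    by blast
  then have "int p dvd (int c - 1) * (int k - int i)"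
    by simp
  moreover have "int p dvd int c * int i + int e - int i"
    using fixed[OF i] .
  ultimately have "int p dvd (int c - 1) * (int k - int i) + (int c * int i + int e - int i)"
    by (rule dvd_add)
  then have "int p dvd int (c * k + e) - int k"
    by (simp add: algebra_simps)
  then have "int k mod int p = int (c * k + e) mod int p"
    by (rule mod_eq_dvd_iff[THEN iffD2, symmetric])
  then have "k mod p = (c * k + e) mod p"
    by (metis zmod_int of_nat_eq_iff)
  then show ?thesis
    using ce[OF k k] by simp
qed

section \<open>Sets of three points\<close>

text \<open>Writing a block as {x i, y i, z i} guarantees neither that its points are distinct nor
  that different indices give different blocks. Both follow by counting: at most p blocks of at most
  three points cover 3p points only if nothing coincides.\<close>

lemma equal_blocks:
  assumes "partition_on \<Omega> (B ` {1..p})" "card \<Omega> = 3 * p"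
    and B: "\<And>i. i \<in> {1..p} \<Longrightarrow> finite (B i) \<and> card (B i) \<le> 3"
  shows "inj_on B {1..p}" "\<And>i. i \<in> {1..p} \<Longrightarrow> card (B i) = 3"
proof -
  have fin: "finite S" if "S \<in> B ` {1..p}" for S
    using that B by blast
  have sum: "3 * p = (\<Sum>S\<in>B ` {1..p}. card S)"
    using product_partition[OF assms(1) fin] assms(2) by simp
  \<comment> \<open>A block that occurs for several indices is counted once on the left and once per
    index on the right.\<close>
  also have "(\<Sum>S\<in>B ` {1..p}. card S) \<le> (\<Sum>i\<in>{1..p}. card (B i))"
    using sum_image_le[of "{1..p}" card B] by (simp add: comp_def)
  finally have le: "3 * p \<le> (\<Sum>i\<in>{1..p}. card (B i))" .
  show card: "card (B i) = 3" if i: "i \<in> {1..p}" for i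
  proof (rule ccontr)
    assume "card (B i) \<noteq> 3"
    then have "(\<Sum>i\<in>{1..p}. card (B i)) < (\<Sum>i\<in>{1..p}. 3)"
      using B i by (intro sum_strict_mono_ex1) (auto intro!: bexI[of _ i] le_neq_implies_less)
    with le show False
      by simp
  qed
  have "3 * p = (\<Sum>S\<in>B ` {1..p}. 3)"
    unfolding sum by (rule sum.cong) (use card in auto)
  then have "card (B ` {1..p}) = card {1..p}"
    by simp
  then show "inj_on B {1..p}"
    by (simp add: eq_card_imp_inj_on)
qed

lemma third_point:
  assumes "card S = 3" "u \<in> S" "v \<in> S" "u \<noteq> v"
  obtains w where "S = {u, v, w}" "u \<noteq> w" "v \<noteq> w"
  using assms by (auto simp: card_3_iff)

text \<open>The exponent of Sym(3) is 6; the case distinction runs through its six elements.\<close>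

lemma funpow_6_three_points:
  assumes "f u \<in> {u, v, w}" "f v \<in> {u, v, w}" "f w \<in> {u, v, w}"
    and "f u \<noteq> f v" "f v \<noteq> f w" "f u \<noteq> f w" and "x \<in> {u, v, w}"
  shows "(f ^^ 6) x = x"
proof -
  have six: "(f ^^ 6) x = f (f (f (f (f (f x)))))"
    by (simp add: numeral_eq_Suc)
  consider "f u = u" "f v = v" "f w = w" | "f u = u" "f v = w" "f w = v"
    | "f u = v" "f v = u" "f w = w" | "f u = v" "f v = w" "f w = u"
    | "f u = w" "f v = v" "f w = u" | "f u = w" "f v = u" "f w = v"
    using assms by (metis empty_iff insert_iff)
  then show ?thesis
    unfolding six using assms(7) by cases auto
qed

section \<open>Permutation groups preserving a partition\<close>

locale imprimitive_perm_group = points: group_action \<Gamma> \<Omega> "\<lambda>g. g"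
  for \<Gamma> :: "('a \<Rightarrow> 'a, 'm) monoid_scheme" (structure) and \<Omega> :: "'a set" +
  fixes \<B> :: "'a set set"
  assumes finite_points: "finite \<Omega>"
    and partition: "partition_on \<Omega> \<B>"
    and block_image: "\<And>g S. g \<in> carrier \<Gamma> \<Longrightarrow> S \<in> \<B> \<Longrightarrow> g ` S \<in> \<B>"
begin

sublocale group \<Gamma>
  using points.group_hom by (simp add: group_hom_def)

lemma block_subset: "S \<in> \<B> \<Longrightarrow> S \<subseteq> \<Omega>"
  using partition by (auto simp: partition_on_def)

lemma block_eqI: "S \<in> \<B> \<Longrightarrow> T \<in> \<B> \<Longrightarrow> \<omega> \<in> S \<Longrightarrow> \<omega> \<in> T \<Longrightarrow> S = T"
  using partition by (auto simp: partition_on_def disjoint_def)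

lemma block_nonempty: "S \<in> \<B> \<Longrightarrow> S \<noteq> {}"
  using partition by (auto simp: partition_on_def)

lemma block_exists: "\<omega> \<in> \<Omega> \<Longrightarrow> \<exists>S\<in>\<B>. \<omega> \<in> S"
  using partition by (auto simp: partition_on_def)

lemma finite_block: "S \<in> \<B> \<Longrightarrow> finite S"
  using block_subset finite_points finite_subset by blast

lemma point_closed: "g \<in> carrier \<Gamma> \<Longrightarrow> \<omega> \<in> \<Omega> \<Longrightarrow> g \<omega> \<in> \<Omega>"
  using points.element_image by blast

lemma mult_apply: "g \<in> carrier \<Gamma> \<Longrightarrow> h \<in> carrier \<Gamma> \<Longrightarrow> \<omega> \<in> \<Omega> \<Longrightarrow> (g \<otimes> h) \<omega> = g (h \<omega>)"
  by (rule points.composition_rule)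

lemma one_apply: "\<omega> \<in> \<Omega> \<Longrightarrow> \<one> \<omega> = \<omega>"
  using points.id_eq_one by (metis restrict_apply')

lemma inv_apply: "g \<in> carrier \<Gamma> \<Longrightarrow> \<omega> \<in> \<Omega> \<Longrightarrow> (inv g) (g \<omega>) = \<omega>"
  using points.orbit_sym_aux by blast

lemma apply_inv: "g \<in> carrier \<Gamma> \<Longrightarrow> \<omega> \<in> \<Omega> \<Longrightarrow> g ((inv g) \<omega>) = \<omega>"
  using inv_apply[of "inv g"] by simp

lemma perm_eqI:
  assumes "g \<in> carrier \<Gamma>" "h \<in> carrier \<Gamma>" "\<And>\<omega>. \<omega> \<in> \<Omega> \<Longrightarrow> g \<omega> = h \<omega>"
  shows "g = h"
  using points.bij_prop0[OF assms(1)] points.bij_prop0[OF assms(2)] assms(3)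
  by (metis Bij_imp_extensional extensionalityI)

lemma inj_perm: "g \<in> carrier \<Gamma> \<Longrightarrow> \<omega> \<in> \<Omega> \<Longrightarrow> \<omega>' \<in> \<Omega> \<Longrightarrow> g \<omega> = g \<omega>' \<longleftrightarrow> \<omega> = \<omega>'"
  by (metis inv_apply)

lemma mult_image: "g \<in> carrier \<Gamma> \<Longrightarrow> h \<in> carrier \<Gamma> \<Longrightarrow> S \<in> \<B> \<Longrightarrow> (g \<otimes> h) ` S = g ` h ` S"
  using block_subset by (force simp: mult_apply image_image cong: image_cong_simp)

lemma one_image: "S \<in> \<B> \<Longrightarrow> \<one> ` S = S"
  using block_subset by (force simp: one_apply cong: image_cong_simp)

lemma inv_image_eq: "g \<in> carrier \<Gamma> \<Longrightarrow> S \<in> \<B> \<Longrightarrow> g ` S = T \<Longrightarrow> (inv g) ` T = S"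
  using mult_image[of "inv g" g S] by (simp add: one_image)

lemma apply_inv_image: "g \<in> carrier \<Gamma> \<Longrightarrow> S \<in> \<B> \<Longrightarrow> g ` (inv g) ` S = S"
  using mult_image[of g "inv g" S] by (simp add: one_image)

lemma finite_carrier: "finite (carrier \<Gamma>)"
proof (rule finite_subset)
  show "carrier \<Gamma> \<subseteq> \<Omega> \<rightarrow>\<^sub>E \<Omega>"
    using points.bij_prop0 by (auto simp: PiE_def Bij_imp_extensional dest!: Bij_imp_funcset)
  show "finite (\<Omega> \<rightarrow>\<^sub>E \<Omega>)"
    by (simp add: finite_PiE finite_points)
qed

lemma finite_blocks: "finite \<B>"
  using finite_elements[OF finite_points partition] .

lemma block_fixed_if_point_fixed:
  assumes "g \<in> carrier \<Gamma>" "S \<in> \<B>" "\<omega> \<in> S" "g \<omega> \<in> S"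
  shows "g ` S = S"
  using block_eqI[OF block_image[OF assms(1,2)] assms(2)] assms(3,4) by blast

text \<open>This is the kernel of the action on blocks in elementwise form;
  \<open>kernel_eq_block_kernel\<close> makes the identification.\<close>

definition block_kernel :: "('a \<Rightarrow> 'a) set" where
  "block_kernel = {g \<in> carrier \<Gamma>. \<forall>S\<in>\<B>. g ` S = S}"

lemma block_kernel_subgroup: "subgroup block_kernel \<Gamma>"
proof (rule subgroupI)
  show "block_kernel \<noteq> {}"
    using one_image by (auto simp: block_kernel_def)
  show "inv g \<in> block_kernel" if "g \<in> block_kernel" for g
    using that by (simp add: block_kernel_def inv_image_eq)
qed (auto simp: block_kernel_def mult_image)

lemma conj_image:
  assumes "g \<in> carrier \<Gamma>" "h \<in> carrier \<Gamma>" "S \<in> \<B>"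
  shows "(inv g \<otimes> h \<otimes> g) ` S = (inv g) ` h ` g ` S"
  using assms by (simp add: mult_image block_image)

lemma block_kernel_normal: "block_kernel \<lhd> \<Gamma>"
proof (rule normal_invI[OF block_kernel_subgroup])
  fix g k assume g: "g \<in> carrier \<Gamma>" and k: "k \<in> block_kernel"
  have "(g \<otimes> k \<otimes> inv g) ` S = S" if S: "S \<in> \<B>" for S
  proof -
    have "(g \<otimes> k \<otimes> inv g) ` S = g ` k ` (inv g) ` S"
      using conj_image[of "inv g" k S] g k S by (simp add: block_kernel_def)
    also have "\<dots> = g ` (inv g) ` S"
      using k g S block_image[of "inv g" S] by (simp add: block_kernel_def)
    also have "\<dots> = S"
      using apply_inv_image g S by simp
    finally show ?thesis .
  qed
  with g k show "g \<otimes> k \<otimes> inv g \<in> block_kernel"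
    by (auto simp: block_kernel_def)
qed

lemma induced_perm_eq:
  assumes "g \<in> carrier \<Gamma>" "S \<in> \<B>"
  shows "induced_perm \<B> g S = g ` S"
  using assms by (simp add: induced_perm_def)

lemma block_action: "group_action \<Gamma> \<B> (induced_perm \<B>)"
proof (unfold group_action_def, intro group_hom.intro group_hom_axioms.intro group_BijGroup is_group homI)
  have Bij: "induced_perm \<B> g \<in> Bij \<B>" if g: "g \<in> carrier \<Gamma>" for g
  proof -
    have "bij_betw (induced_perm \<B> g) \<B> \<B>"
      by (rule bij_betwI[where g = "induced_perm \<B> (inv g)"])
        (use g in \<open>simp_all add: induced_perm_eq block_image apply_inv_image inv_image_eq[OF g _ refl]\<close>)
    then show ?thesis
      by (simp add: Bij_def induced_perm_def)
  qed
  then show "induced_perm \<B> g \<in> carrier (BijGroup \<B>)" if "g \<in> carrier \<Gamma>" for g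
    using that by (simp add: BijGroup_def)
  fix g h assume gh: "g \<in> carrier \<Gamma>" "h \<in> carrier \<Gamma>"
  have "induced_perm \<B> (g \<otimes> h) = compose \<B> (induced_perm \<B> g) (induced_perm \<B> h)"
    using gh by (intro ext) (simp add: induced_perm_def compose_def mult_image block_image)
  then show "induced_perm \<B> (g \<otimes> h) = induced_perm \<B> g \<otimes>\<^bsub>BijGroup \<B>\<^esub> induced_perm \<B> h"
    using gh Bij by (simp add: BijGroup_def)
qed

sublocale blocks: group_action \<Gamma> \<B> "induced_perm \<B>"
  by (rule block_action)

sublocale induced: group_hom \<Gamma> "BijGroup \<B>" "induced_perm \<B>"
  by (rule blocks.group_hom)

lemma kernel_eq_block_kernel: "kernel \<Gamma> (BijGroup \<B>) (induced_perm \<B>) = block_kernel"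
proof -
  have "induced_perm \<B> g = \<one>\<^bsub>BijGroup \<B>\<^esub> \<longleftrightarrow> (\<forall>S\<in>\<B>. g ` S = S)" for g :: "'a \<Rightarrow> 'a"
    by (auto simp: induced_perm_def BijGroup_def fun_eq_iff restrict_def)
  then show ?thesis
    by (simp add: kernel_def block_kernel_def)
qed

text \<open>The intended \<open>A\<close> is the group generated by \<alpha>. Its invariance is
  available only under conjugation by images of elements of \<Gamma>, not in the whole symmetric
  group on the blocks.\<close>

lemma normal_preimage:
  assumes A: "subgroup A (BijGroup \<B>)"
    and normal: "\<And>g u. g \<in> carrier \<Gamma> \<Longrightarrow> u \<in> A \<Longrightarrow>
      induced_perm \<B> g \<otimes>\<^bsub>BijGroup \<B>\<^esub> u \<otimes>\<^bsub>BijGroup \<B>\<^esub> inv\<^bsub>BijGroup \<B>\<^esub> induced_perm \<B> g \<in> A"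
  shows "{g \<in> carrier \<Gamma>. induced_perm \<B> g \<in> A} \<lhd> \<Gamma>"
proof (rule normal_invI)
  show "subgroup {g \<in> carrier \<Gamma>. induced_perm \<B> g \<in> A} \<Gamma>"
  proof (rule subgroupI)
    show "{g \<in> carrier \<Gamma>. induced_perm \<B> g \<in> A} \<noteq> {}"
      using subgroup.one_closed[OF A] induced.hom_one by force
  qed (use A in \<open>auto simp: subgroup.m_closed subgroup.m_inv_closed\<close>)
qed (use normal in auto)

lemma setwise_stabilizer_subgroup:
  assumes S: "S \<in> \<B>"
  shows "subgroup {g \<in> carrier \<Gamma>. g ` S = S} \<Gamma>"
proof (rule subgroupI)
  show "{g \<in> carrier \<Gamma>. g ` S = S} \<noteq> {}"
    using one_image[OF S] by blast
  show "inv g \<in> {g \<in> carrier \<Gamma>. g ` S = S}" if "g \<in> {g \<in> carrier \<Gamma>. g ` S = S}" for g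
    using that S inv_image_eq[of g S S] by simp
  show "g \<otimes> h \<in> {g \<in> carrier \<Gamma>. g ` S = S}"
    if "g \<in> {g \<in> carrier \<Gamma>. g ` S = S}" "h \<in> {g \<in> carrier \<Gamma>. g ` S = S}" for g h
    using that S mult_image[of g h S] by simp
qed auto

lemma point_stabilizer_subgroup: "\<omega> \<in> \<Omega> \<Longrightarrow> subgroup {g \<in> carrier \<Gamma>. g \<omega> = \<omega>} \<Gamma>"
  using points.stabilizer_subgroup by (simp add: stabilizer_def)

text \<open>This turns the intersection condition into a statement about fixed points of
  quotients.\<close>

lemma agree_iff:
  assumes "f \<in> carrier \<Gamma>" "g \<in> carrier \<Gamma>" "\<omega> \<in> \<Omega>"
  shows "f \<omega> = g \<omega> \<longleftrightarrow> (inv f \<otimes> g) \<omega> = \<omega>"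
  using assms by (metis apply_inv inv_apply inv_closed mult_apply point_closed)

lemma intersecting_translate:
  assumes g: "g \<in> carrier \<Gamma>" and F: "F \<subseteq> carrier \<Gamma>" "intersecting \<Omega> F"
  shows "intersecting \<Omega> ((\<lambda>f. g \<otimes> f) ` F)"
  unfolding intersecting_def
proof clarify
  fix f h assume "f \<in> F" "h \<in> F"
  moreover from this obtain \<omega> where "\<omega> \<in> \<Omega>" "f \<omega> = h \<omega>"
    using F(2) unfolding intersecting_def by blast
  ultimately show "\<exists>\<omega>\<in>\<Omega>. (g \<otimes> f) \<omega> = (g \<otimes> h) \<omega>"
    using F g by (metis mult_apply subsetD)
qed

lemma card_translate:
  assumes "g \<in> carrier \<Gamma>" "F \<subseteq> carrier \<Gamma>"
  shows "card ((\<lambda>f. g \<otimes> f) ` F) = card F"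
  using assms by (intro card_image inj_onI) (auto simp: subset_iff)

end


section \<open>The abstract setting with blocks of size three\<close>

text \<open>In the application \<open>N\<close> is the preimage of the group generated by \<alpha>,
  \<open>S\<^sub>0\<close> is the block fixed by \<beta>, and \<open>d\<close> is the order of
  \<beta>. Regularity of that cyclic group on the blocks becomes \<open>N_semiregular\<close> and
  \<open>N_transitive\<close>, the affine action becomes \<open>two_blocks_fixed\<close>, and the
  semidirect decomposition becomes \<open>generated\<close>.\<close>

locale imprimitive_triples = imprimitive_perm_group +
  fixes N :: "('a \<Rightarrow> 'a) set" and b :: "'a \<Rightarrow> 'a" and S\<^sub>0 :: "'a set" and d :: nat
  assumes block_card: "\<And>S. S \<in> \<B> \<Longrightarrow> card S = 3"
    and transitive: "\<And>\<omega> \<omega>'. \<omega> \<in> \<Omega> \<Longrightarrow> \<omega>' \<in> \<Omega> \<Longrightarrow> \<exists>g\<in>carrier \<Gamma>. g \<omega> = \<omega>'"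
    and kernel_nontrivial: "block_kernel \<noteq> {\<one>}"
    and kernel_no_derangement: "\<And>k. k \<in> block_kernel \<Longrightarrow> \<not> derangement \<Omega> k"
    and kernel_no_involution: "\<And>k. k \<in> block_kernel \<Longrightarrow> ord k \<noteq> 2"
    and N_normal: "N \<lhd> \<Gamma>"
    and kernel_subset_N: "block_kernel \<subseteq> N"
    and N_semiregular: "\<And>n S. n \<in> N \<Longrightarrow> S \<in> \<B> \<Longrightarrow> n ` S = S \<Longrightarrow> n \<in> block_kernel"
    and N_transitive: "\<And>S. S \<in> \<B> \<Longrightarrow> \<exists>n\<in>N. n ` S\<^sub>0 = S"
    and two_blocks_fixed: "\<And>g S T. g \<in> carrier \<Gamma> \<Longrightarrow> S \<in> \<B> \<Longrightarrow> T \<in> \<B> \<Longrightarrow> S \<noteq> T \<Longrightarrow>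
          g ` S = S \<Longrightarrow> g ` T = T \<Longrightarrow> g \<in> block_kernel"
    and S\<^sub>0: "S\<^sub>0 \<in> \<B>"
    and b: "b \<in> carrier \<Gamma>" "b ` S\<^sub>0 = S\<^sub>0" "restricts_to_transposition b S\<^sub>0"
    and b_pow: "\<And>j::int. b [^] j \<in> block_kernel \<longleftrightarrow> int d dvd j"
    and d: "even d" "d > 0"
    and generated: "\<And>g. g \<in> carrier \<Gamma> \<Longrightarrow> \<exists>n\<in>N. \<exists>j::int. g = n \<otimes> b [^] j"
begin

section \<open>The action of the kernel on a block\<close>

abbreviation "K \<equiv> block_kernel"

lemma K_carrier: "k \<in> K \<Longrightarrow> k \<in> carrier \<Gamma>"
  by (simp add: block_kernel_def)

lemma K_point: "k \<in> K \<Longrightarrow> S \<in> \<B> \<Longrightarrow> \<omega> \<in> S \<Longrightarrow> k \<omega> \<in> S"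
  by (auto simp: block_kernel_def)

lemma finite_K: "finite K"
  using finite_carrier by (rule finite_subset[rotated]) (auto simp: block_kernel_def)

text \<open>Each block has three points, so k^6 = 1. The power k^3 lies in \<open>K\<close> and
  squares to 1, hence is trivial because \<open>K\<close> has no involution. If \<open>k\<close>
  fixed one point of the block and moved another, it would swap the two remaining points,
  contradicting k^3 = 1.\<close>

lemma K_fixes_block_pointwise:
  assumes k: "k \<in> K" and S: "S \<in> \<B>" and \<omega>: "\<omega> \<in> S" "k \<omega> = \<omega>" and \<omega>': "\<omega>' \<in> S"
  shows "k \<omega>' = \<omega>'"
proof (rule ccontr)
  assume moved: "k \<omega>' \<noteq> \<omega>'"
  have kc: "k \<in> carrier \<Gamma>"
    using k by (rule K_carrier)
  have pow: "(k [^] n) \<nu> = (k ^^ n) \<nu>" if "\<nu> \<in> \<Omega>" for n :: nat and \<nu>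
    using that
  proof (induction n arbitrary: \<nu>)
    case (Suc n)
    then show ?case
      using kc point_closed[OF kc] by (simp add: mult_apply funpow_swap1)
  qed (simp add: one_apply)
  have six: "(k ^^ 6) \<nu> = \<nu>" if \<nu>: "\<nu> \<in> \<Omega>" for \<nu>
  proof -
    obtain T where T: "T \<in> \<B>" "\<nu> \<in> T"
      using block_exists[OF \<nu>] by blast
    obtain u v w where uvw: "T = {u, v, w}" "u \<noteq> v" "v \<noteq> w" "u \<noteq> w"
      using block_card[OF T(1)] by (auto simp: card_3_iff)
    have "k u \<in> T" "k v \<in> T" "k w \<in> T"
      using K_point[OF k T(1)] uvw by auto
    moreover have "k u \<noteq> k v" "k v \<noteq> k w" "k u \<noteq> k w"
      using inj_perm[OF kc] block_subset[OF T(1)] uvw by auto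
    ultimately show ?thesis
      using funpow_6_three_points[of k u v w \<nu>] T(2) unfolding uvw(1) by blast
  qed
  have "(k [^] (3::nat)) [^] (2::nat) = \<one>"
    unfolding nat_pow_pow[OF kc]
    by (rule perm_eqI) (use kc pow six one_apply in auto)
  then have "ord (k [^] (3::nat)) dvd 2"
    using kc by (simp add: pow_eq_id)
  moreover have "k [^] n \<in> K" for n :: nat
    by (induction n)
      (use k subgroup.one_closed subgroup.m_closed block_kernel_subgroup in \<open>auto\<close>)
  then have "ord (k [^] (3::nat)) \<noteq> 2"
    using kernel_no_involution by blast
  ultimately have "ord (k [^] (3::nat)) = 1"
    by (metis prime_nat_iff two_is_prime_nat)
  then have "k [^] (3::nat) = \<one>"
    using kc ord_eq_1 nat_pow_closed by blast
  then have three: "(k ^^ 3) \<nu> = \<nu>" if "\<nu> \<in> \<Omega>" for \<nu>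
    using pow[OF that, of 3] one_apply[OF that] by simp
  obtain \<nu> where \<nu>: "S = {\<omega>, \<omega>', \<nu>}" "\<omega> \<noteq> \<nu>" "\<omega>' \<noteq> \<nu>"
    using third_point[OF block_card[OF S] \<omega>(1) \<omega>'] moved \<omega>(2) by metis
  then have "k \<omega>' = \<nu>" "k \<nu> = \<omega>'"
    using K_point[OF k S, of \<omega>'] K_point[OF k S, of \<nu>] moved \<omega> inj_perm[OF kc] block_subset[OF S]
    by auto
  then show False
    using three[of \<omega>'] \<nu> block_subset[OF S] by (auto simp: numeral_eq_Suc)
qed

text \<open>A nontrivial element of \<open>K\<close> moves some point. Transitivity and normality of
  \<open>K\<close> allow a conjugation that places this point in \<open>S\<close>, and an element of
  \<open>K\<close> moving one point of a block moves all of them.\<close>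

lemma K_moves_every_block:
  assumes S: "S \<in> \<B>"
  obtains k where "k \<in> K" "\<And>\<omega>. \<omega> \<in> S \<Longrightarrow> k \<omega> \<noteq> \<omega>"
proof -
  obtain k where k: "k \<in> K" "k \<noteq> \<one>"
    using kernel_nontrivial subgroup.one_closed[OF block_kernel_subgroup] by blast
  then obtain \<nu> where \<nu>: "\<nu> \<in> \<Omega>" "k \<nu> \<noteq> \<nu>"
    using perm_eqI[OF K_carrier one_closed] one_apply by metis
  obtain \<omega> where \<omega>: "\<omega> \<in> S"
    using block_nonempty[OF S] by blast
  then have \<omega>': "\<omega> \<in> \<Omega>"
    using block_subset[OF S] by blast
  obtain g where g: "g \<in> carrier \<Gamma>" "g \<omega> = \<nu>"
    using transitive[OF \<omega>' \<nu>(1)] by blast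
  define h where "h = inv g \<otimes> k \<otimes> g"
  have h: "h \<in> K"
    unfolding h_def using normal.inv_op_closed1[OF block_kernel_normal g(1) k(1)] .
  have kc: "k \<in> carrier \<Gamma>"
    using k K_carrier by blast
  have "h \<omega> = (inv g) (k \<nu>)"
    unfolding h_def using g kc \<omega>' by (simp add: mult_apply \<nu>)
  then have "h \<omega> \<noteq> \<omega>"
    using g kc \<nu> by (metis apply_inv point_closed)
  then have "h \<omega>' \<noteq> \<omega>'" if "\<omega>' \<in> S" for \<omega>'
    using K_fixes_block_pointwise[OF h S that] \<omega> by blast
  with h show thesis
    using that by blast
qed

text \<open>If \<open>k\<close> moves every point of the block of \<omega>, the translates of the
  stabilizer by 1, k and k^2 send \<omega> to three different points. They are therefore disjoint
  subsets of \<open>K\<close> of equal size.\<close>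

lemma K_point_stabilizer:
  assumes \<omega>: "\<omega> \<in> \<Omega>"
  shows "3 * card {k \<in> K. k \<omega> = \<omega>} \<le> card K"
proof -
  obtain S where S: "S \<in> \<B>" "\<omega> \<in> S"
    using block_exists[OF \<omega>] by blast
  obtain k where k: "k \<in> K" "\<And>\<nu>. \<nu> \<in> S \<Longrightarrow> k \<nu> \<noteq> \<nu>"
    using K_moves_every_block[OF S(1)] by blast
  have kc: "k \<in> carrier \<Gamma>"
    using k K_carrier by blast
  define X where "X = {k \<in> K. k \<omega> = \<omega>}"
  define Y where "Y = (\<lambda>h. k \<otimes> h) ` X"
  define Z where "Z = (\<lambda>h. k \<otimes> h) ` Y"
  have sub: "X \<subseteq> K" "Y \<subseteq> K" "Z \<subseteq> K"
    unfolding X_def Y_def Z_def using k subgroup.m_closed[OF block_kernel_subgroup] by auto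
  then have car: "X \<subseteq> carrier \<Gamma>" "Y \<subseteq> carrier \<Gamma>"
    using K_carrier by blast+
  have card: "card Y = card X" "card Z = card X"
    using card_translate[OF kc car(1)] card_translate[OF kc car(2)] by (auto simp: Y_def Z_def)
  have at: "h \<in> X \<Longrightarrow> h \<omega> = \<omega>" "h \<in> Y \<Longrightarrow> h \<omega> = k \<omega>" "h \<in> Z \<Longrightarrow> h \<omega> = k (k \<omega>)" for h
    using car \<omega> kc by (auto simp: X_def Y_def Z_def mult_apply K_carrier)
  have "k \<omega> \<in> S" "k (k \<omega>) \<in> S"
    using K_point[OF k(1) S(1)] S(2) by auto
  then have d1: "k \<omega> \<noteq> \<omega>" "k (k \<omega>) \<noteq> k \<omega>"
    using k S by auto
  \<comment> \<open>Otherwise \<open>k\<close> exchanges two points of the block and has to fix the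
    third.\<close>
  have d2: "k (k \<omega>) \<noteq> \<omega>"
  proof
    assume eq: "k (k \<omega>) = \<omega>"
    obtain \<nu> where \<nu>: "S = {\<omega>, k \<omega>, \<nu>}" "\<omega> \<noteq> \<nu>" "k \<omega> \<noteq> \<nu>"
      using third_point[OF block_card[OF S(1)] S(2) \<open>k \<omega> \<in> S\<close>] d1 by metis
    then have n: "\<nu> \<in> S" "\<nu> \<noteq> \<omega>" "\<nu> \<noteq> k \<omega>"
      by blast+
    have "k \<nu> \<in> S"
      using K_point[OF k(1) S(1) n(1)] .
    moreover have "k \<nu> \<noteq> \<nu>"
      using k n by blast
    ultimately have "k \<nu> = \<omega> \<or> k \<nu> = k \<omega>"
      using \<nu> by blast
    then show False
      using n eq inj_perm[OF kc, of \<nu>] \<open>k \<omega> \<in> S\<close> S(2) block_subset[OF S(1)] by (metis subsetD)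
  qed
  have fin: "finite X" "finite Y" "finite Z"
    using finite_K sub finite_subset by blast+
  have "h \<notin> Y" if "h \<in> X" for h
    using at(1)[OF that] at(2)[of h] d1 by auto
  moreover have "h \<notin> Z" if "h \<in> X \<union> Y" for h
    using that at[of h] d1 d2 by auto
  ultimately have disj: "X \<inter> Y = {}" "(X \<union> Y) \<inter> Z = {}"
    by blast+
  have "card X + card Y + card Z = card (X \<union> Y \<union> Z)"
    using card_Un_disjoint[OF fin(1,2) disj(1)] card_Un_disjoint[OF _ fin(3) disj(2)] fin by simp
  also have "\<dots> \<le> card K"
    using sub finite_K by (intro card_mono) auto
  finally show ?thesis
    using card unfolding X_def by linarith
qed


section \<open>Exponents of \<open>b\<close> modulo \<open>N\<close>\<close>

lemma N_subgroup: "subgroup N \<Gamma>"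
  using N_normal by (rule normal_imp_subgroup)

lemma N_carrier: "n \<in> N \<Longrightarrow> n \<in> carrier \<Gamma>"
  using N_subgroup subgroup.subset by blast

lemma b_pow_carrier: "b [^] (j::int) \<in> carrier \<Gamma>"
  using b(1) by simp

lemma b_pow_image: "(b [^] (j::int)) ` S\<^sub>0 = S\<^sub>0"
  using subgroup_int_pow_closed[OF setwise_stabilizer_subgroup[OF S\<^sub>0], of b j] b by simp

text \<open>A relation rather than a function, since an exponent may be changed by multiples of
  \<open>d\<close>.\<close>

definition exponent :: "('a \<Rightarrow> 'a) \<Rightarrow> int \<Rightarrow> bool" where
  "exponent g j \<longleftrightarrow> (\<exists>n\<in>N. g = n \<otimes> b [^] j)"

lemma exponent_exists: "g \<in> carrier \<Gamma> \<Longrightarrow> \<exists>j. exponent g j"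
  unfolding exponent_def using generated by blast

lemma exponent_carrier: "exponent g j \<Longrightarrow> g \<in> carrier \<Gamma>"
  using N_carrier b_pow_carrier by (auto simp: exponent_def)

text \<open>Read in the factor group by \<open>N\<close>, exponents add under multiplication because
  cosets of a normal subgroup multiply.\<close>

lemma exponent_iff_coset:
  assumes "g \<in> carrier \<Gamma>"
  shows "exponent g j \<longleftrightarrow> N #> g = N #> (b [^] j)"
proof
  assume "exponent g j"
  then have "g \<in> N #> (b [^] j)"
    by (auto simp: exponent_def r_coset_def)
  then show "N #> g = N #> (b [^] j)"
    using repr_independence N_subgroup b_pow_carrier by metis
next
  assume "N #> g = N #> (b [^] j)"
  then have "g \<in> N #> (b [^] j)"
    using rcos_self[OF assms N_subgroup] by simp
  then show "exponent g j"
    by (auto simp: exponent_def r_coset_def)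
qed

lemma exponent_mult:
  assumes "exponent g i" "exponent h j"
  shows "exponent (g \<otimes> h) (i + j)"
proof -
  have c: "g \<in> carrier \<Gamma>" "h \<in> carrier \<Gamma>"
    using assms exponent_carrier by auto
  have "N #> (g \<otimes> h) = (N #> g) <#> (N #> h)"
    using normal.rcos_sum[OF N_normal c] by simp
  also have "\<dots> = (N #> (b [^] i)) <#> (N #> (b [^] j))"
    using assms c by (simp add: exponent_iff_coset)
  also have "\<dots> = N #> (b [^] (i + j))"
    using normal.rcos_sum[OF N_normal b_pow_carrier b_pow_carrier] b(1) by (simp add: int_pow_mult)
  finally show ?thesis
    using c by (simp add: exponent_iff_coset)
qed

lemma exponent_N: "n \<in> N \<Longrightarrow> exponent n 0"
  using N_carrier by (auto simp: exponent_def)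

lemma exponent_b_pow: "exponent (b [^] j) j"
  unfolding exponent_def
  by (rule bexI[OF _ subgroup.one_closed[OF N_subgroup]]) (simp add: b_pow_carrier)

lemma exponent_inv:
  assumes "exponent g j"
  shows "exponent (inv g) (- j)"
proof -
  obtain n where n: "n \<in> N" "g = n \<otimes> b [^] j"
    using assms by (auto simp: exponent_def)
  then have "inv g = b [^] (- j) \<otimes> inv n"
    using N_carrier[OF n(1)] b by (simp add: inv_mult_group int_pow_neg)
  then show ?thesis
    using exponent_mult[OF exponent_b_pow exponent_N, of "inv n" "- j"]
      subgroup.m_inv_closed[OF N_subgroup n(1)] by simp
qed

lemma exponent_0_iff: "exponent g 0 \<longleftrightarrow> g \<in> N"
  using exponent_N N_carrier by (auto simp: exponent_def)

lemma exponent_cong: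
  assumes "exponent g i" "int d dvd j - i"
  shows "exponent g j"
proof -
  have "exponent (b [^] (j - i)) 0"
    using assms(2) b_pow kernel_subset_N exponent_N by blast
  \<comment> \<open>The power b^(j - i) has the exponents 0 and j - i at once, so its quotient by
    itself gives \<one> the exponent j - i.\<close>
  from exponent_mult[OF exponent_inv[OF this] exponent_b_pow[of "j - i"]]
  have "exponent \<one> (j - i)"
    using b_pow_carrier by simp
  from exponent_mult[OF this assms(1)] show ?thesis
    using exponent_carrier[OF assms(1)] by simp
qed

section \<open>Elements of even exponent\<close>

text \<open>As \<open>d\<close> is even, changing an exponent by a multiple of \<open>d\<close>
  preserves its parity.\<close>

definition even_part :: "('a \<Rightarrow> 'a) set" where
  "even_part = {g. \<exists>j. even j \<and> exponent g j}"

lemma even_part_carrier: "even_part \<subseteq> carrier \<Gamma>"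
  using exponent_carrier by (auto simp: even_part_def)

lemma even_part_quotient:
  assumes "f \<in> even_part" "g \<in> even_part"
  shows "inv f \<otimes> g \<in> even_part"
proof -
  obtain i j where "even i" "exponent f i" "even j" "exponent g j"
    using assms by (auto simp: even_part_def)
  then have "exponent (inv f \<otimes> g) (- i + j)" "even (- i + j)"
    using exponent_mult[OF exponent_inv] by auto
  then show ?thesis
    unfolding even_part_def by blast
qed

text \<open>The square of a transposition is the identity, so \<open>b \<otimes> b\<close> lies in
  the stabilizer of every point of \<open>S\<^sub>0\<close>.\<close>

lemma b_even_pow_fixes:
  assumes "\<omega> \<in> S\<^sub>0" "even j"
  shows "(b [^] (j::int)) \<omega> = \<omega>"
proof -
  obtain i where j: "j = 2 * i"
    using assms(2) by blast
  obtain u v where uv: "u \<in> S\<^sub>0" "v \<in> S\<^sub>0" "\<And>w. w \<in> S\<^sub>0 \<Longrightarrow> b w = transpose u v w"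
    using b(3) by (auto simp: restricts_to_transposition_def)
  have \<omega>: "\<omega> \<in> \<Omega>"
    using assms(1) block_subset[OF S\<^sub>0] by blast
  have "b \<omega> \<in> S\<^sub>0"
    using assms(1) b(2) by blast
  then have "(b \<otimes> b) \<omega> = \<omega>"
    using uv(3) assms(1) \<omega> b(1) by (simp add: mult_apply)
  then have "((b \<otimes> b) [^] i) \<omega> = \<omega>"
    using subgroup_int_pow_closed[OF point_stabilizer_subgroup[OF \<omega>], of "b \<otimes> b" i] b(1) by simp
  moreover have "b [^] j = (b \<otimes> b) [^] i"
    using b(1) int_pow_pow[of b 2 i] int_pow_mult[of b 1 1] by (simp add: j)
  ultimately show ?thesis
    by simp
qed

text \<open>
  Conjugating by an element of \<open>N\<close> moves the fixed block to \<open>S\<^sub>0\<close>, where even powers of \<open>b\<close> act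
  trivially.
\<close>

lemma even_part_fixes_block_pointwise:
  assumes e: "e \<in> even_part" and S: "S \<in> \<B>" and \<omega>: "\<omega> \<in> S" "e \<omega> = \<omega>" and \<omega>': "\<omega>' \<in> S"
  shows "e \<omega>' = \<omega>'"
proof -
  obtain j where j: "even j" "exponent e j"
    using e by (auto simp: even_part_def)
  have ec: "e \<in> carrier \<Gamma>"
    using j(2) exponent_carrier by blast
  have eS: "e ` S = S"
    using block_fixed_if_point_fixed[OF ec S \<omega>(1)] \<omega> by simp
  obtain n where n: "n \<in> N" "n ` S\<^sub>0 = S"
    using N_transitive[OF S] by blast
  have nc: "n \<in> carrier \<Gamma>"
    using n N_carrier by blast
  have "exponent (inv n \<otimes> e \<otimes> n) j"
    using exponent_mult[OF exponent_mult[OF exponent_inv[OF exponent_N[OF n(1)]] j(2)] exponent_N[OF n(1)]]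
    by simp
  then obtain m where m: "m \<in> N" "inv n \<otimes> e \<otimes> n = m \<otimes> b [^] j"
    by (auto simp: exponent_def)
  have mc: "m \<in> carrier \<Gamma>"
    using m N_carrier by blast
  \<comment> \<open>The factor b^j acts trivially on \<open>S\<^sub>0\<close>, so there the
    conjugate of \<open>e\<close> coincides with \<open>m\<close>.\<close>
  have on_S\<^sub>0: "m \<nu> = (inv n) (e (n \<nu>))" if \<nu>: "\<nu> \<in> S\<^sub>0" for \<nu>
  proof -
    have "\<nu> \<in> \<Omega>"
      using \<nu> block_subset[OF S\<^sub>0] by blast
    then have "(m \<otimes> b [^] j) \<nu> = m \<nu>"
      using b_even_pow_fixes[OF \<nu> j(1)] mc b_pow_carrier by (simp add: mult_apply)
    moreover have "(inv n \<otimes> e \<otimes> n) \<nu> = (inv n) (e (n \<nu>))"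
      using \<open>\<nu> \<in> \<Omega>\<close> nc ec by (simp add: mult_apply point_closed)
    ultimately show ?thesis
      using m(2) by simp
  qed
  have "m ` S\<^sub>0 = (inv n) ` e ` n ` S\<^sub>0"
    using on_S\<^sub>0 by (force simp: image_image)
  then have "m ` S\<^sub>0 = S\<^sub>0"
    using n(2) eS inv_image_eq[OF nc S\<^sub>0 n(2)] by simp
  \<comment> \<open>Now \<open>m\<close> belongs to the kernel, where fixing one point of a block
    means fixing all three.\<close>
  then have mK: "m \<in> K"
    using N_semiregular[OF m(1) S\<^sub>0] by blast
  obtain \<nu> \<nu>' where \<nu>: "\<nu> \<in> S\<^sub>0" "\<omega> = n \<nu>" "\<nu>' \<in> S\<^sub>0" "\<omega>' = n \<nu>'"
    using n(2) \<omega>(1) \<omega>' by blast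
  then have \<nu>\<Omega>: "\<nu> \<in> \<Omega>" "\<nu>' \<in> \<Omega>"
    using block_subset[OF S\<^sub>0] by blast+
  have "m \<nu> = \<nu>"
    using on_S\<^sub>0[OF \<nu>(1)] \<omega>(2) \<nu> inv_apply[OF nc \<nu>\<Omega>(1)] by simp
  then have "m \<nu>' = \<nu>'"
    using K_fixes_block_pointwise[OF mK S\<^sub>0 \<nu>(1) _ \<nu>(3)] by blast
  then have "(inv n) (e \<omega>') = \<nu>'"
    using on_S\<^sub>0[OF \<nu>(3)] \<nu>(4) by simp
  then have "n \<nu>' = e \<omega>'"
    using apply_inv[OF nc] point_closed[OF ec] point_closed[OF nc] \<nu>\<Omega> \<nu>(4) by metis
  then show ?thesis
    using \<nu>(4) by simp
qed

section \<open>The upper bound for intersecting families\<close>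

text \<open>Let \<open>f\<close> and \<open>f'\<close> agree at \<omega>. Every member
  \<open>g\<close> with the exponent of \<open>f\<close> turns out to agree with \<open>f'\<close>,
  hence with \<open>f\<close>, at the same \<omega>. So the whole class lies in the translate by
  \<open>f\<close> of the stabilizer of \<omega> in \<open>K\<close>.\<close>

lemma card_label_class:
  assumes F: "F \<subseteq> even_part" "intersecting \<Omega> F"
    and f: "f \<in> F" "f' \<in> F" "inv f \<otimes> f' \<notin> K" "exponent f j"
  shows "3 * card {g \<in> F. exponent g j} \<le> card K"
proof -
  have car: "g \<in> carrier \<Gamma>" if "g \<in> F" for g
    using that F(1) even_part_carrier by blast
  obtain \<omega> where \<omega>: "\<omega> \<in> \<Omega>" "f \<omega> = f' \<omega>"
    using F(2) f by (auto simp: intersecting_def)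
  obtain S where S: "S \<in> \<B>" "\<omega> \<in> S"
    using block_exists[OF \<omega>(1)] by blast
  define e where "e = inv f \<otimes> f'"
  have ec: "e \<in> carrier \<Gamma>"
    unfolding e_def using f car by simp
  have "e \<omega> = \<omega>"
    unfolding e_def using agree_iff[OF car[OF f(1)] car[OF f(2)] \<omega>(1)] \<omega>(2) by simp
  then have eS: "e ` S = S"
    using block_fixed_if_point_fixed[OF ec S] S(2) by simp
  have "g \<in> (\<lambda>k. f \<otimes> k) ` {k \<in> K. k \<omega> = \<omega>}" if g: "g \<in> F" "exponent g j" for g
  proof -
    define h where "h = inv f \<otimes> g"
    have gc: "g \<in> carrier \<Gamma>" and fc: "f \<in> carrier \<Gamma>" and fc': "f' \<in> carrier \<Gamma>"
      using g f car by auto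
    \<comment> \<open>Equal exponents cancel, which puts \<open>h\<close> in \<open>N\<close>; a
      common value of \<open>f\<close> and \<open>g\<close> is a fixed point of \<open>h\<close> and
      puts it in \<open>K\<close>.\<close>
    have hN: "h \<in> N"
      using exponent_mult[OF exponent_inv[OF f(4)] g(2)] by (simp add: h_def exponent_0_iff)
    have hc: "h \<in> carrier \<Gamma>"
      using hN N_carrier by blast
    obtain \<mu> where \<mu>: "\<mu> \<in> \<Omega>" "f \<mu> = g \<mu>"
      using F(2) f g by (auto simp: intersecting_def)
    then have "h \<mu> = \<mu>"
      unfolding h_def using agree_iff[OF fc gc] by blast
    then have hK: "h \<in> K"
      using block_exists[OF \<mu>(1)] block_fixed_if_point_fixed[OF hc] N_semiregular[OF hN] by metis
    have g_eq: "g = f \<otimes> h"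
      unfolding h_def using gc fc by (simp add: m_assoc[symmetric])
    obtain \<nu> where \<nu>: "\<nu> \<in> \<Omega>" "g \<nu> = f' \<nu>"
      using F(2) f g by (auto simp: intersecting_def)
    obtain T where T: "T \<in> \<B>" "\<nu> \<in> T"
      using block_exists[OF \<nu>(1)] by blast
    \<comment> \<open>At \<nu> the maps \<open>g\<close> and \<open>f'\<close> agree, so
      \<open>e\<close> acts there like \<open>h\<close>, which preserves \<open>T\<close>. As
      \<open>e\<close> is outside \<open>K\<close>, it fixes only one block, which yields T =
      S.\<close>
    have "e ` T = T"
    proof -
      have "h \<nu> \<in> T"
        using K_point[OF hK T] .
      moreover have "e \<nu> = h \<nu>"
        unfolding e_def h_def using \<nu> fc fc' gc by (simp add: mult_apply)
      ultimately show ?thesis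
        using block_fixed_if_point_fixed[OF ec T] by simp
    qed
    then have "T = S"
      using two_blocks_fixed[OF ec S(1) T(1)] eS f(3) e_def by blast
    have "(inv g \<otimes> f') \<nu> = \<nu>"
      using agree_iff[OF gc fc' \<nu>(1)] \<nu>(2) by blast
    then have "(inv g \<otimes> f') \<omega> = \<omega>"
      using even_part_fixes_block_pointwise[OF even_part_quotient T _ S(2)[folded \<open>T = S\<close>]]
        F(1) f g by blast
    then have "g \<omega> = f' \<omega>"
      using agree_iff[OF gc fc' \<omega>(1)] by blast
    then have "h \<omega> = \<omega>"
      unfolding h_def using agree_iff[OF fc gc \<omega>(1)] \<omega>(2) by simp
    with hK g_eq show ?thesis
      by blast
  qed
  then have "card {g \<in> F. exponent g j} \<le> card ((\<lambda>k. f \<otimes> k) ` {k \<in> K. k \<omega> = \<omega>})"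
    using finite_K by (intro card_mono) auto
  also have "\<dots> \<le> card {k \<in> K. k \<omega> = \<omega>}"
    using finite_K by (intro card_image_le) auto
  finally show ?thesis
    using K_point_stabilizer[OF \<omega>(1)] by linarith
qed

text \<open>Either \<open>F\<close> lies in one coset of \<open>K\<close>, or
  \<open>card_label_class\<close> applies to each of the d/2 even residues modulo \<open>d\<close>.
  The factor 6 clears the denominators of both bounds.\<close>

lemma card_intersecting_even_part:
  assumes F: "F \<subseteq> even_part" "intersecting \<Omega> F"
  shows "6 * card F \<le> max 6 d * card K"
proof (cases "\<forall>f\<in>F. \<forall>g\<in>F. inv f \<otimes> g \<in> K")
  case True
  have "card F \<le> card K"
  proof (cases "F = {}")
    case False
    then obtain f where f: "f \<in> F"
      by blast
    have fc: "f \<in> carrier \<Gamma>"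
      using f F(1) even_part_carrier by blast
    have "(\<lambda>g. inv f \<otimes> g) ` F \<subseteq> K"
      using True f by blast
    then have "card ((\<lambda>g. inv f \<otimes> g) ` F) \<le> card K"
      using card_mono[OF finite_K] by blast
    then show ?thesis
      using card_translate[of "inv f" F] fc F(1) even_part_carrier by auto
  qed simp
  then show ?thesis
    by (simp add: max_def mult_mono)
next
  case False
  then obtain f\<^sub>1 f\<^sub>2 where f12: "f\<^sub>1 \<in> F" "f\<^sub>2 \<in> F" "inv f\<^sub>1 \<otimes> f\<^sub>2 \<notin> K"
    by blast
  have car: "g \<in> carrier \<Gamma>" if "g \<in> F" for g
    using that F(1) even_part_carrier by blast
  have finF: "finite F"
    using finite_subset[OF _ finite_carrier] car by blast
  \<comment> \<open>If \<open>f\<close> shared its coset of \<open>K\<close> with both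
    \<open>f\<^sub>1\<close> and \<open>f\<^sub>2\<close>, these two would share a coset as
    well.\<close>
  have other: "\<exists>f'\<in>F. inv f \<otimes> f' \<notin> K" if f: "f \<in> F" for f
  proof (rule ccontr)
    assume "\<not> ?thesis"
    then have "inv f \<otimes> f\<^sub>1 \<in> K" "inv f \<otimes> f\<^sub>2 \<in> K"
      using f12 by auto
    then have "inv (inv f \<otimes> f\<^sub>1) \<otimes> (inv f \<otimes> f\<^sub>2) \<in> K"
      using subgroup.m_closed[OF block_kernel_subgroup] subgroup.m_inv_closed[OF block_kernel_subgroup]
      by blast
    moreover have "inv (inv f \<otimes> f\<^sub>1) \<otimes> (inv f \<otimes> f\<^sub>2) = inv f\<^sub>1 \<otimes> (f \<otimes> inv f) \<otimes> f\<^sub>2"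
      using car[OF f] car[OF f12(1)] car[OF f12(2)] by (simp only: inv_mult_group inv_closed inv_inv m_assoc m_closed)
    ultimately show False
      using f12 car[OF f] car[OF f12(1)] by simp
  qed
  \<comment> \<open>The even representatives 0, 2, ..., d - 2 of the residues modulo
    \<open>d\<close>.\<close>
  let ?C = "(\<lambda>i. 2 * int i) ` {..<d div 2}"
  let ?F = "\<lambda>j. {g \<in> F. exponent g j}"
  have "F \<subseteq> (\<Union>j\<in>?C. ?F j)"
  proof
    fix f assume f: "f \<in> F"
    then obtain j where j: "even j" "exponent f j"
      using F(1) by (auto simp: even_part_def)
    have "exponent f (j mod int d)"
      using exponent_cong[OF j(2)] by (simp add: mod_eq_dvd_iff[symmetric])
    moreover have "even (j mod int d)"
      using j(1) d(1) by (simp add: dvd_mod)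
    moreover have "0 \<le> j mod int d" "j mod int d < int d"
      using d(2) by auto
    ultimately obtain i where "j mod int d = 2 * i" "0 \<le> i" "2 * i < int d" "exponent f (2 * i)"
      by auto
    then have "nat i \<in> {..<d div 2}" "2 * int (nat i) = 2 * i"
      using d(1) by auto
    then show "f \<in> (\<Union>j\<in>?C. ?F j)"
      using f \<open>exponent f (2 * i)\<close> by force
  qed
  then have "card F \<le> (\<Sum>j\<in>?C. card (?F j))"
    using card_mono[of "\<Union>j\<in>?C. ?F j" F] card_UN_le[of ?C ?F] finF by fastforce
  then have "3 * card F \<le> (\<Sum>j\<in>?C. 3 * card (?F j))"
    by (simp add: sum_distrib_left[symmetric])
  also have "\<dots> \<le> (\<Sum>j\<in>?C. card K)"
  proof (rule sum_mono)
    fix j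
    show "3 * card (?F j) \<le> card K"
    proof (cases "?F j = {}")
      case False
      then show ?thesis
        using card_label_class[OF F] other by blast
    next
      case True
      then show ?thesis
        by (simp only: card.empty)
    qed
  qed
  also have "\<dots> \<le> d div 2 * card K"
    using card_image_le[of "{..<d div 2}" "\<lambda>i. 2 * int i"] by simp
  finally have "6 * card F \<le> (2 * (d div 2)) * card K"
    by linarith
  also have "\<dots> \<le> max 6 d * card K"
    using d(1) by (intro mult_right_mono) auto
  finally show ?thesis .
qed

text \<open>Left translation by \<open>inv b\<close> carries the members of odd exponent into
  \<open>even_part\<close>. The even bound thus applies to both halves of \<open>F\<close>, and
  adding them halves the factor 6.\<close>

lemma card_intersecting:
  assumes F: "F \<subseteq> carrier \<Gamma>" "intersecting \<Omega> F"
  shows "3 * card F \<le> max 6 d * card K"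
proof -
  have sub: "intersecting \<Omega> F'" if "F' \<subseteq> F" for F'
    using F(2) that by (auto simp: intersecting_def)
  let ?O = "F - even_part"
  have "(\<lambda>g. inv b \<otimes> g) ` ?O \<subseteq> even_part"
  proof clarify
    fix g assume g: "g \<in> F" "g \<notin> even_part"
    then obtain j where j: "exponent g j"
      using F(1) exponent_exists by blast
    then have "odd j"
      using g(2) by (auto simp: even_part_def)
    moreover have "exponent (inv b \<otimes> g) (-1 + j)"
      using exponent_mult[OF exponent_inv[OF exponent_b_pow[of 1]] j] b(1) by simp
    ultimately show "inv b \<otimes> g \<in> even_part"
      unfolding even_part_def by (auto intro!: exI[of _ "-1 + j"])
  qed
  moreover have "intersecting \<Omega> ((\<lambda>g. inv b \<otimes> g) ` ?O)"
    using intersecting_translate[of "inv b" ?O] b(1) F(1) sub by auto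
  ultimately have "6 * card ((\<lambda>g. inv b \<otimes> g) ` ?O) \<le> max 6 d * card K"
    by (rule card_intersecting_even_part)
  then have "6 * card ?O \<le> max 6 d * card K"
    using card_translate[of "inv b" ?O] b(1) F(1) by (simp add: subset_iff)
  moreover have "6 * card (F \<inter> even_part) \<le> max 6 d * card K"
    using sub by (intro card_intersecting_even_part) auto
  moreover have "card F = card (F \<inter> even_part) + card ?O"
    using finite_subset[OF F(1) finite_carrier] card_Int_Diff by blast
  ultimately show ?thesis
    by linarith
qed

section \<open>Orders of block and point stabilizers\<close>

text \<open>Powers of \<open>b\<close> fix \<open>S\<^sub>0\<close>, so the \<open>N\<close>-part of
  an element fixing \<open>S\<^sub>0\<close> fixes it too and lies in \<open>K\<close>. Hence the
  stabilizer consists of the products k b^j, unique for 0 \<le> j < d because \<open>b\<close> has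
  order \<open>d\<close> modulo \<open>K\<close>.\<close>

lemma card_block_stabilizer: "card {g \<in> carrier \<Gamma>. g ` S\<^sub>0 = S\<^sub>0} = d * card K"
proof -
  let ?f = "\<lambda>(k, j::int). k \<otimes> b [^] j"
  have "inj_on ?f (K \<times> {0..<int d})"
  proof (rule inj_onI, clarify)
    fix k k' :: "'a \<Rightarrow> 'a" and j j' :: int
    assume k: "k \<in> K" "k' \<in> K" and j: "j \<in> {0..<int d}" "j' \<in> {0..<int d}"
      and eq: "k \<otimes> b [^] j = k' \<otimes> b [^] j'"
    have kc: "k \<in> carrier \<Gamma>" "k' \<in> carrier \<Gamma>"
      using k K_carrier by auto
    have "b [^] (j - j') = b [^] j \<otimes> inv (b [^] j')"
      using b(1) by (simp add: int_pow_diff)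
    also have "\<dots> = inv k \<otimes> (k \<otimes> b [^] j) \<otimes> inv (b [^] j')"
      using kc b_pow_carrier by (simp add: m_assoc[symmetric])
    also have "\<dots> = inv k \<otimes> k'"
      unfolding eq using kc b_pow_carrier by (simp add: m_assoc)
    also have "\<dots> \<in> K"
      using k block_kernel_subgroup by (simp add: subgroup.m_closed subgroup.m_inv_closed)
    finally have "int d dvd j - j'"
      using b_pow by simp
    then have "j = j'"
      using j zdvd_imp_le[of "int d" "\<bar>j - j'\<bar>"] by (cases "j = j'") auto
    then show "k = k' \<and> j = j'"
      using eq kc b_pow_carrier by simp
  qed
  moreover have "?f ` (K \<times> {0..<int d}) = {g \<in> carrier \<Gamma>. g ` S\<^sub>0 = S\<^sub>0}"
  proof (intro equalityI subsetI)
    fix g assume "g \<in> ?f ` (K \<times> {0..<int d})"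
    then obtain k j where "k \<in> K" "g = k \<otimes> b [^] (j::int)"
      by auto
    then show "g \<in> {g \<in> carrier \<Gamma>. g ` S\<^sub>0 = S\<^sub>0}"
      using b_pow_carrier b_pow_image S\<^sub>0 by (simp add: K_carrier mult_image) (simp add: block_kernel_def)
  next
    fix g assume "g \<in> {g \<in> carrier \<Gamma>. g ` S\<^sub>0 = S\<^sub>0}"
    then have g: "g \<in> carrier \<Gamma>" "g ` S\<^sub>0 = S\<^sub>0"
      by auto
    obtain j where "exponent g j"
      using exponent_exists[OF g(1)] by blast
    then have "exponent g (j mod int d)"
      by (rule exponent_cong) (simp add: mod_eq_dvd_iff[symmetric])
    then obtain n where n: "n \<in> N" "g = n \<otimes> b [^] (j mod int d)"
      by (auto simp: exponent_def)
    have "n ` S\<^sub>0 = S\<^sub>0"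
      using g(2) n b_pow_carrier b_pow_image S\<^sub>0 N_carrier by (simp add: mult_image)
    then have "n \<in> K"
      using N_semiregular[OF n(1) S\<^sub>0] by blast
    then show "g \<in> ?f ` (K \<times> {0..<int d})"
      using n(2) d(2) by (intro image_eqI[of _ _ "(n, j mod int d)"]) auto
  qed
  ultimately show ?thesis
    using card_image[of ?f "K \<times> {0..<int d}"] by (simp add: card_cartesian_product mult.commute)
qed

text \<open>Computing the order of \<Gamma> by orbits of points and by orbits of blocks gives two
  products; comparing them with |\<Omega>| = 3 |\<B>| leaves the claim.\<close>

lemma card_point_stabilizer:
  assumes \<omega>: "\<omega> \<in> \<Omega>"
  shows "3 * card {g \<in> carrier \<Gamma>. g \<omega> = \<omega>} = d * card K"
proof -
  have "orbit \<Gamma> (\<lambda>g. g) \<omega> = \<Omega>"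
    using transitive[OF \<omega>] point_closed[OF _ \<omega>] unfolding orbit_def by force
  then have "order \<Gamma> = card \<Omega> * card {g \<in> carrier \<Gamma>. g \<omega> = \<omega>}"
    using points.orbit_stabilizer_theorem[OF \<omega>] by (simp add: stabilizer_def)
  moreover have "orbit \<Gamma> (induced_perm \<B>) S\<^sub>0 = \<B>"
  proof -
    have "S \<in> orbit \<Gamma> (induced_perm \<B>) S\<^sub>0" if S: "S \<in> \<B>" for S
    proof -
      obtain n where "n \<in> carrier \<Gamma>" "n ` S\<^sub>0 = S"
        using N_transitive[OF S] N_carrier by blast
      then show ?thesis
        using induced_perm_eq[OF _ S\<^sub>0, of n] unfolding orbit_def by blast
    qed
    moreover have "orbit \<Gamma> (induced_perm \<B>) S\<^sub>0 \<subseteq> \<B>"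
      by (auto simp: orbit_def block_image[OF _ S\<^sub>0] induced_perm_eq[OF _ S\<^sub>0])
    ultimately show ?thesis
      by blast
  qed
  moreover have "stabilizer \<Gamma> (induced_perm \<B>) S\<^sub>0 = {g \<in> carrier \<Gamma>. g ` S\<^sub>0 = S\<^sub>0}"
    using induced_perm_eq[OF _ S\<^sub>0] by (auto simp: stabilizer_def)
  ultimately have "card \<Omega> * card {g \<in> carrier \<Gamma>. g \<omega> = \<omega>} = card \<B> * (d * card K)"
    using blocks.orbit_stabilizer_theorem[OF S\<^sub>0] card_block_stabilizer by simp
  moreover have "card \<Omega> = 3 * card \<B>"
    using product_partition[OF partition] block_card finite_block by (simp add: mult.commute)
  moreover have "card \<B> > 0"
    using S\<^sub>0 finite_blocks card_gt_0_iff by blast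
  ultimately show ?thesis
    by simp
qed

section \<open>The intersecting family formed by two cosets of the kernel\<close>

text \<open>On \<open>S\<^sub>0\<close> the element \<open>k\<close> is the identity or a 3-cycle
  while \<open>b\<close> is a transposition, so their product is odd in Sym(3) and fixes a point of
  \<open>S\<^sub>0\<close>.\<close>

lemma kernel_coset_fixes_point:
  assumes k: "k \<in> K"
  shows "\<exists>\<omega>\<in>\<Omega>. b (k \<omega>) = \<omega>"
proof -
  have kc: "k \<in> carrier \<Gamma>"
    using k K_carrier by blast
  obtain u v where uv: "u \<in> S\<^sub>0" "v \<in> S\<^sub>0" "u \<noteq> v" "\<And>w. w \<in> S\<^sub>0 \<Longrightarrow> b w = transpose u v w"
    using b(3) by (auto simp: restricts_to_transposition_def)
  obtain w where w: "S\<^sub>0 = {u, v, w}" "u \<noteq> w" "v \<noteq> w"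
    using third_point[OF block_card[OF S\<^sub>0] uv(1,2,3)] by blast
  have b_apply: "b u = v" "b v = u" "b w = w"
    using uv w by auto
  have in_\<Omega>: "u \<in> \<Omega>" "v \<in> \<Omega>" "w \<in> \<Omega>"
    using w(1) block_subset[OF S\<^sub>0] by auto
  show ?thesis
  proof (cases "k w = w")
    case True
    then show ?thesis
      using b_apply in_\<Omega> by metis
  next
    case False
    have moved: "k v \<noteq> v"
      using K_fixes_block_pointwise[OF k S\<^sub>0, of v w] w False by auto
    have "k u \<noteq> u"
      using K_fixes_block_pointwise[OF k S\<^sub>0, of u w] w False by auto
    then consider "k u = v" | "k u = w"
      using K_point[OF k S\<^sub>0 uv(1)] w by blast
    then show ?thesis
    proof cases
      case 1
      then show ?thesis
        using b_apply in_\<Omega> by metis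
    next
      case 2
      then have "k v = u"
        using K_point[OF k S\<^sub>0 uv(2)] w moved inj_perm[OF kc] in_\<Omega> uv(3) by (metis empty_iff insert_iff)
      then show ?thesis
        using b_apply in_\<Omega> by metis
    qed
  qed
qed

text \<open>Two elements of the same coset agree somewhere because \<open>K\<close> contains no
  derangement. For elements of different cosets the quotient lies in b K and has a fixed point in
  \<open>S\<^sub>0\<close>.\<close>

lemma intersecting_kernel_cosets: "intersecting \<Omega> (K \<union> (\<lambda>k. b \<otimes> k) ` K)"
proof -
  have kernel: "\<exists>\<omega>\<in>\<Omega>. f \<omega> = g \<omega>" if "f \<in> K" "g \<in> K" for f g
  proof -
    have "inv f \<otimes> g \<in> K"
      using that block_kernel_subgroup by (simp add: subgroup.m_closed subgroup.m_inv_closed)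
    then obtain \<omega> where "\<omega> \<in> \<Omega>" "(inv f \<otimes> g) \<omega> = \<omega>"
      using kernel_no_derangement by (auto simp: derangement_def)
    then show ?thesis
      using agree_iff[OF K_carrier K_carrier] that by blast
  qed
  have mixed: "\<exists>\<omega>\<in>\<Omega>. f \<omega> = (b \<otimes> g) \<omega>" if "f \<in> K" "g \<in> K" for f g
  proof -
    have c: "f \<in> carrier \<Gamma>" "g \<in> carrier \<Gamma>"
      using that K_carrier by auto
    \<comment> \<open>Chosen so that \<open>b \<otimes> h\<close> is the quotient of
      \<open>f\<close> and \<open>b \<otimes> g\<close>; normality of \<open>K\<close> puts
      \<open>h\<close> in \<open>K\<close>.\<close>
    define h where "h = inv b \<otimes> inv f \<otimes> b \<otimes> g"
    have "h \<in> K"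
      unfolding h_def using that block_kernel_subgroup normal.inv_op_closed1[OF block_kernel_normal b(1)]
      by (simp add: subgroup.m_closed subgroup.m_inv_closed)
    then obtain \<omega> where \<omega>: "\<omega> \<in> \<Omega>" "b (h \<omega>) = \<omega>"
      using kernel_coset_fixes_point by blast
    have "b \<otimes> h = inv f \<otimes> (b \<otimes> g)"
      unfolding h_def using b(1) c by (simp add: m_assoc[symmetric])
    then have "(inv f \<otimes> (b \<otimes> g)) \<omega> = \<omega>"
      using \<omega> mult_apply[OF b(1) K_carrier[OF \<open>h \<in> K\<close>] \<omega>(1)] by simp
    then show ?thesis
      using agree_iff[of f "b \<otimes> g" \<omega>] c b(1) \<omega>(1) by auto
  qed
  have coset: "\<exists>\<omega>\<in>\<Omega>. (b \<otimes> f) \<omega> = (b \<otimes> g) \<omega>" if "f \<in> K" "g \<in> K" for f g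
    using kernel[OF that] that K_carrier b(1) mult_apply by metis
  show ?thesis
    unfolding intersecting_def using kernel mixed coset by (auto, metis)
qed

lemma card_kernel_cosets: "card (K \<union> (\<lambda>k. b \<otimes> k) ` K) = 2 * card K"
proof -
  have "b \<notin> K"
  proof
    assume "b \<in> K"
    then have "int d dvd 1"
      using b_pow[of 1] b(1) by simp
    then show False
      using d by simp
  qed
  have "b \<otimes> k \<notin> K" if k: "k \<in> K" for k
  proof
    assume "b \<otimes> k \<in> K"
    then have "b \<otimes> k \<otimes> inv k \<in> K"
      using k block_kernel_subgroup by (simp add: subgroup.m_closed subgroup.m_inv_closed)
    then show False
      using \<open>b \<notin> K\<close> b(1) K_carrier[OF k] by (simp add: m_assoc)
  qed
  then have "K \<inter> (\<lambda>k. b \<otimes> k) ` K = {}"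
    by blast
  then have "card (K \<union> (\<lambda>k. b \<otimes> k) ` K) = card K + card ((\<lambda>k. b \<otimes> k) ` K)"
    using finite_K by (intro card_Un_disjoint) auto
  also have "card ((\<lambda>k. b \<otimes> k) ` K) = card K"
    using card_translate[OF b(1)] K_carrier by blast
  finally show ?thesis
    by simp
qed

section \<open>The value of the density\<close>

lemma Max_card_intersecting:
  assumes \<omega>: "\<omega> \<in> \<Omega>"
  shows "Max {card F | F. F \<subseteq> carrier \<Gamma> \<and> intersecting \<Omega> F} =
           max (2 * card K) (card {g \<in> carrier \<Gamma>. g \<omega> = \<omega>})"
    (is "Max ?M = ?m")
proof (rule Max_eqI)
  show "finite ?M"
    by (rule finite_subset[of _ "card ` Pow (carrier \<Gamma>)"]) (auto simp: finite_carrier)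
  show "n \<le> ?m" if "n \<in> ?M" for n
  proof -
    have "3 * n \<le> max 6 d * card K"
      using that card_intersecting by auto
    \<comment> \<open>The stabilizer has order d |K| / 3, so the two terms of the maximum match the
      two sides of the upper bound.\<close>
    also have "\<dots> = 3 * ?m"
      using card_point_stabilizer[OF \<omega>] by (simp add: nat_mult_max_left nat_mult_max_right)
    finally show ?thesis
      by simp
  qed
  have "2 * card K \<in> ?M"
    using card_kernel_cosets[symmetric] intersecting_kernel_cosets K_carrier b(1) by blast
  moreover have "card {g \<in> carrier \<Gamma>. g \<omega> = \<omega>} \<in> ?M"
    using \<omega> by (auto simp: intersecting_def intro!: exI[of _ "{g \<in> carrier \<Gamma>. g \<omega> = \<omega>}"] bexI[of _ \<omega>])
  ultimately show "?m \<in> ?M"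
    by (simp add: max_def)
qed

lemma density:
  assumes \<omega>: "\<omega> \<in> \<Omega>"
  shows "intersection_density \<Omega> (carrier \<Gamma>) \<omega> = max 1 (6 / real d)"
proof -
  let ?s = "card {g \<in> carrier \<Gamma>. g \<omega> = \<omega>}"
  have s: "3 * real ?s = real d * real (card K)"
    using arg_cong[OF card_point_stabilizer[OF \<omega>], of real] by simp
  have K_pos: "card K > 0"
    using finite_K subgroup.one_closed[OF block_kernel_subgroup] card_gt_0_iff by blast
  then have "real d * real (card K) > 0"
    using d(2) by simp
  then have s_pos: "real ?s > 0"
    using s by linarith
  have "intersection_density \<Omega> (carrier \<Gamma>) \<omega> = real (max (2 * card K) ?s) / real ?s"
    using Max_card_intersecting[OF \<omega>] by (simp add: intersection_density_def stabilizer_def)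
  also have "\<dots> = max (2 * real (card K) / real ?s) 1"
    using s_pos by (simp add: max_def divide_simps)
  also have "2 * real (card K) / real ?s = 6 / real d"
    using s s_pos d(2) by (simp add: field_simps)
  finally show ?thesis
    by (simp add: max.commute)
qed

end

section \<open>Passage from the concrete group to the abstract setting\<close>

theorem theorem7p6:
  fixes p d t :: nat
    and \<Omega> :: "'a set"
    and G K :: "('a \<Rightarrow> 'a) set"
    and x y z :: "nat \<Rightarrow> 'a"
    and B :: "nat \<Rightarrow> 'a set"
    and \<B> :: "'a set set"
    and Gbar :: "('a set \<Rightarrow> 'a set) set"
    and \<alpha> \<beta> :: "'a set \<Rightarrow> 'a set"
    and a b :: "'a \<Rightarrow> 'a"
  assumes p: "prime p" "p \<ge> 5"
    and \<Omega>: "card \<Omega> = 3 * p"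
    and G: "transitive_perm_group \<Omega> G"
    and B: "\<And>i. i \<in> {1..p} \<Longrightarrow> B i = {x i, y i, z i}"
    and \<B>: "\<B> = B ` {1..p}"
    and only_partition:
      "\<And>P. invariant_partition \<Omega> G P \<and> nontrivial_partition \<Omega> P \<longleftrightarrow> P = \<B>"
    and Gbar: "Gbar = induced_perm \<B> ` G"
    and K: "K = kernel (perm_group \<Omega> G) (BijGroup \<B>) (induced_perm \<B>)"
    and K_nontrivial: "K \<noteq> {\<one>\<^bsub>BijGroup \<Omega>\<^esub>}"
    and K_no_derangement: "\<And>k. k \<in> K \<Longrightarrow> \<not> derangement \<Omega> k"
    and K_minimal_normal:
      "\<And>N. minimal_normal N (perm_group \<Omega> G) \<Longrightarrow> N \<subseteq> K \<Longrightarrow>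
         elementary_abelian 3 (perm_group \<Omega> N)"
    and K_no_involution: "\<And>k. k \<in> K \<Longrightarrow> group.ord (BijGroup \<Omega>) k \<noteq> 2"
    and Gbar_solvable: "solvable (perm_group \<B> Gbar)"
    and Gbar_noncyclic: "\<not> cyclic_group (perm_group \<B> Gbar)"
    and \<alpha>: "\<alpha> \<in> carrier (BijGroup \<B>)" "\<And>i. i \<in> {1..p} \<Longrightarrow> \<alpha> (B i) = B (i mod p + 1)"
    and \<beta>: "\<beta> \<in> carrier (BijGroup \<B>)" "\<beta> (B 1) = B 1"
    and Gbar_semidirect:
      "semidirect (perm_group \<B> Gbar) (generate (BijGroup \<B>) {\<alpha>}) (generate (BijGroup \<B>) {\<beta>})"
    and Gbar_affine: "Gbar \<subseteq> AGL1 p B"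
    and d: "group.ord (BijGroup \<B>) \<beta> = d" "even d" "d dvd p - 1"
    and t: "coprime t p"
      "\<beta> \<otimes>\<^bsub>BijGroup \<B>\<^esub> \<alpha> \<otimes>\<^bsub>BijGroup \<B>\<^esub> inv\<^bsub>BijGroup \<B>\<^esub> \<beta> = \<alpha> [^]\<^bsub>BijGroup \<B>\<^esub> t"
    and a: "a \<in> G" "induced_perm \<B> a = \<alpha>"
      "\<And>i. i \<in> {1..p} \<Longrightarrow> a (x i) = x (i mod p + 1)"
      "\<And>i. i \<in> {1..p} \<Longrightarrow> a (y i) = y (i mod p + 1)"
      "\<And>i. i \<in> {1..p} \<Longrightarrow> a (z i) = z (i mod p + 1)"
    and b: "b \<in> G" "induced_perm \<B> b = \<beta>" "restricts_to_transposition b (B 1)"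
  shows "\<forall>\<omega>\<in>\<Omega>.
      intersection_density \<Omega> (generate (BijGroup \<Omega>) (K \<union> {a, b})) \<omega> = max 1 (6 / real d) \<and>
      (d \<le> 6 \<longrightarrow>
        intersection_density \<Omega> (generate (BijGroup \<Omega>) (K \<union> {a, b})) \<omega> \<in> {1, 3 / 2, 3})"
proof -
  define \<Gamma> where "\<Gamma> = perm_group \<Omega> G"
  let ?\<Delta> = "BijGroup \<B>"
  let ?\<phi> = "induced_perm \<B>"
  let ?A = "generate ?\<Delta> {\<alpha>}"
  interpret \<Delta>: group ?\<Delta>
    by (rule group_BijGroup)
  have G_sub: "subgroup G (BijGroup \<Omega>)" and "transitive_action \<Gamma> \<Omega> (\<lambda>g. g)"
    using G by (auto simp: transitive_perm_group_def \<Gamma>_def)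
  then interpret points: transitive_action \<Gamma> \<Omega> "\<lambda>g. g"
    by simp
  have car: "carrier \<Gamma> = G"
    by (simp add: \<Gamma>_def)
  have p_pos: "p > 0"
    using p by simp
  have part: "partition_on \<Omega> \<B>" and image: "\<And>g S. g \<in> G \<Longrightarrow> S \<in> \<B> \<Longrightarrow> g ` S \<in> \<B>"
    using only_partition[of \<B>] by (auto simp: invariant_partition_def)
  have "finite (B i) \<and> card (B i) \<le> 3" if "i \<in> {1..p}" for i
    using card_length[of "[x i, y i, z i]"] by (simp add: B[OF that])
  note eq = equal_blocks[OF part[unfolded \<B>] \<Omega> this]
  have B1: "B 1 \<in> \<B>"
    using p_pos by (auto simp: \<B>)
  interpret imprimitive_perm_group \<Gamma> \<Omega> \<B>
  proof
    show "finite \<Omega>"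
      using \<Omega> p_pos by (intro card_ge_0_finite) simp
  qed (use part image car in auto)
  \<comment> \<open>An element of infinite order would have \<open>ord\<close> equal to 0; the
    symmetric group on the blocks is finite.\<close>
  have d_pos: "0 < d"
    using \<Delta>.ord_ge_1[OF finite_BijGroup[OF finite_blocks] \<beta>(1)] d(1) by simp
  have K_eq: "K = block_kernel"
    unfolding K by (simp only: \<Gamma>_def[symmetric] kernel_eq_block_kernel)

  have A_sub: "subgroup ?A ?\<Delta>"
    using \<Delta>.generate_is_subgroup \<alpha>(1) by simp
  have A_transitive: "\<exists>u\<in>?A. u (B 1) = S" if S: "S \<in> \<B>" for S
  proof -
    obtain i where i: "i \<in> {1..p}" "S = B i"
      using S \<B> by blast
    have "i - 1 < p" "i - 1 + 1 = i"
      using i(1) by auto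
    then have "(\<alpha> [^]\<^bsub>?\<Delta>\<^esub> (i - 1)) (B 1) = S"
      using cycle_pow_apply[OF \<alpha>[unfolded \<B>]] i(2) unfolding \<B> by metis
    moreover have "\<alpha> [^]\<^bsub>?\<Delta>\<^esub> int (i - 1) \<in> ?A"
      by (rule \<Delta>.subgroup_int_pow_closed[OF A_sub generate.incl]) simp
    ultimately show ?thesis
      by (metis int_pow_int)
  qed
  \<comment> \<open>A transitive abelian group is regular: if \<open>u\<close> fixes one block,
    commuting with elements that carry \<open>B 1\<close> to any other block makes \<open>u\<close>
    fix them all.\<close>
  have A_semiregular: "u = \<one>\<^bsub>?\<Delta>\<^esub>" if u: "u \<in> ?A" and S: "S \<in> \<B>" "u S = S" for u S
  proof (rule BijGroup_eqI)
    show uc: "u \<in> carrier ?\<Delta>"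
      using u A_sub subgroup.subset by blast
    fix T assume T: "T \<in> \<B>"
    obtain v w where vw: "v \<in> ?A" "v (B 1) = S" "w \<in> ?A" "w (B 1) = T"
      using A_transitive S(1) T by metis
    have c: "v \<in> carrier ?\<Delta>" "w \<in> carrier ?\<Delta>"
      using vw A_sub subgroup.subset by blast+
    have comm: "f (g Q) = g (f Q)" if "f \<in> ?A" "g \<in> ?A" "Q \<in> \<B>" for f g Q
    proof -
      have "f \<in> carrier ?\<Delta>" "g \<in> carrier ?\<Delta>"
        using that A_sub subgroup.subset by blast+
      then show ?thesis
        using \<Delta>.generate_singleton_commute[OF \<alpha>(1) that(1,2)] that(3)
          BijGroup_mult_apply by metis
    qed
    have "v (u (B 1)) = v (B 1)"
      using comm[OF vw(1) u B1] vw(2) S(2) by simp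
    then have "u (B 1) = B 1"
      using c(1) B1 BijGroup_apply_closed[OF uc B1]
      by (auto simp: BijGroup_def Bij_def bij_betw_def inj_on_def)
    then have "u T = T"
      using comm[OF u vw(3) B1] vw(4) by simp
    then show "u T = \<one>\<^bsub>?\<Delta>\<^esub> T"
      using T by (simp add: BijGroup_def)
  qed simp

  have Gbar_sub: "subgroup Gbar ?\<Delta>"
    unfolding Gbar car[symmetric] using induced.img_is_subgroup .
  have A_normal: "?A \<lhd> perm_group \<B> Gbar"
    and Gbar_eq: "?A <#>\<^bsub>perm_group \<B> Gbar\<^esub> generate ?\<Delta> {\<beta>} = Gbar"
    using Gbar_semidirect by (auto simp: semidirect_def)
  define N where "N = {g \<in> carrier \<Gamma>. ?\<phi> g \<in> ?A}"
  have A_Gbar: "?A \<subseteq> Gbar"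
    using normal_imp_subgroup[OF A_normal] subgroup.subset by fastforce
  have N_normal: "N \<lhd> \<Gamma>"
    unfolding N_def
  proof (rule normal_preimage[OF A_sub])
    fix g u assume g: "g \<in> carrier \<Gamma>" and u: "u \<in> ?A"
    have "?\<phi> g \<in> Gbar"
      using g by (simp add: Gbar car)
    then show "?\<phi> g \<otimes>\<^bsub>?\<Delta>\<^esub> u \<otimes>\<^bsub>?\<Delta>\<^esub> inv\<^bsub>?\<Delta>\<^esub> ?\<phi> g \<in> ?A"
      using normal.inv_op_closed2[OF A_normal, of "?\<phi> g" u] u \<Delta>.m_inv_consistent[OF Gbar_sub] by simp
  qed
  have b_car: "b \<in> carrier \<Gamma>"
    using b(1) car by simp
  have b_pow: "b [^]\<^bsub>\<Gamma>\<^esub> j \<in> block_kernel \<longleftrightarrow> int d dvd j" for j :: int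
  proof -
    have "b [^]\<^bsub>\<Gamma>\<^esub> j \<in> block_kernel \<longleftrightarrow> ?\<phi> (b [^]\<^bsub>\<Gamma>\<^esub> j) = \<one>\<^bsub>?\<Delta>\<^esub>"
      unfolding kernel_eq_block_kernel[symmetric] using b_car by (simp add: kernel_def)
    also have "?\<phi> (b [^]\<^bsub>\<Gamma>\<^esub> j) = \<beta> [^]\<^bsub>?\<Delta>\<^esub> j"
      using induced.hom_int_pow[OF b_car] b(2) by simp
    also have "\<dots> = \<one>\<^bsub>?\<Delta>\<^esub> \<longleftrightarrow> int d dvd j"
      using \<Delta>.int_pow_eq_id[OF \<beta>(1)] d(1) by simp
    finally show ?thesis .
  qed
  have generated: "\<exists>n\<in>N. \<exists>j::int. g = n \<otimes>\<^bsub>\<Gamma>\<^esub> b [^]\<^bsub>\<Gamma>\<^esub> j" if g: "g \<in> carrier \<Gamma>" for g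
  proof -
    have "?\<phi> g \<in> ?A <#>\<^bsub>perm_group \<B> Gbar\<^esub> generate ?\<Delta> {\<beta>}"
      unfolding Gbar_eq using g by (simp add: Gbar car)
    then obtain u v where uv: "u \<in> ?A" "v \<in> generate ?\<Delta> {\<beta>}" "?\<phi> g = u \<otimes>\<^bsub>?\<Delta>\<^esub> v"
      by (auto simp: set_mult_def)
    then obtain j :: int where j: "v = \<beta> [^]\<^bsub>?\<Delta>\<^esub> j"
      using \<Delta>.generate_pow[OF \<beta>(1)] by auto
    have v: "?\<phi> (b [^]\<^bsub>\<Gamma>\<^esub> j) = v"
      using induced.hom_int_pow[OF b_car] b(2) j by simp
    have uc: "u \<in> carrier ?\<Delta>"
      using uv(1) A_sub subgroup.subset by blast
    \<comment> \<open>Dividing off the power of \<open>b\<close> that accounts for the \<beta>-part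
      of the image leaves an element mapped into the group generated by \<alpha>.\<close>
    define n where "n = g \<otimes>\<^bsub>\<Gamma>\<^esub> inv\<^bsub>\<Gamma>\<^esub> (b [^]\<^bsub>\<Gamma>\<^esub> j)"
    have "?\<phi> n = u"
      unfolding n_def using g b_car uv(3) v uc \<beta>(1) j by (simp add: \<Delta>.m_assoc)
    then have "n \<in> N"
      using uv(1) g b_car by (simp add: N_def n_def)
    moreover have "g = n \<otimes>\<^bsub>\<Gamma>\<^esub> b [^]\<^bsub>\<Gamma>\<^esub> j"
      unfolding n_def using g b_car by (simp add: m_assoc)
    ultimately show ?thesis
      by blast
  qed
  \<comment> \<open>Powers in a subgroup agree with those in the full symmetric group, so the
    hypothesis on involutions transfers to \<Gamma>.\<close>
  have ord_eq: "group.ord (BijGroup \<Omega>) g = ord g" for g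
    unfolding ord_def group.ord_def[OF group_BijGroup]
    by (simp add: \<Gamma>_def monoid.nat_pow_consistent[OF group.is_monoid[OF group_BijGroup], of _ _ _ G, symmetric])

  interpret imprimitive_triples \<Gamma> \<Omega> \<B> N b "B 1" d
  proof (intro imprimitive_triples.intro imprimitive_triples_axioms.intro imprimitive_perm_group_axioms)
    show "card S = 3" if "S \<in> \<B>" for S
      using that eq(2) \<B> by blast
    show "\<exists>g\<in>carrier \<Gamma>. g \<omega> = \<omega>'" if "\<omega> \<in> \<Omega>" "\<omega>' \<in> \<Omega>" for \<omega> \<omega>'
      using points.unique_orbit[OF that] .
    show "block_kernel \<noteq> {\<one>\<^bsub>\<Gamma>\<^esub>}"
      using K_nontrivial by (simp add: K_eq \<Gamma>_def)
    show "\<not> derangement \<Omega> k" "ord k \<noteq> 2" if "k \<in> block_kernel" for k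
      using that K_no_derangement K_no_involution by (simp_all add: K_eq ord_eq)
    show "block_kernel \<subseteq> N"
      unfolding kernel_eq_block_kernel[symmetric] using subgroup.one_closed[OF A_sub]
      by (auto simp: N_def kernel_def)
    show "n \<in> block_kernel" if "n \<in> N" "S \<in> \<B>" "n ` S = S" for n S
      unfolding kernel_eq_block_kernel[symmetric]
      using that A_semiregular[of "?\<phi> n" S] by (simp add: N_def kernel_def induced_perm_eq)
    show "\<exists>n\<in>N. n ` B 1 = S" if S: "S \<in> \<B>" for S
    proof -
      obtain u where u: "u \<in> ?A" "u (B 1) = S"
        using A_transitive[OF S] by blast
      then obtain n where "n \<in> carrier \<Gamma>" "?\<phi> n = u"
        using A_Gbar unfolding Gbar car by blast
      then show ?thesis
        using u induced_perm_eq[OF _ B1, of n] by (auto simp: N_def)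
    qed
    show "g \<in> block_kernel"
      if g: "g \<in> carrier \<Gamma>" and ST: "S \<in> \<B>" "T \<in> \<B>" "S \<noteq> T" "g ` S = S" "g ` T = T" for g S T
    proof -
      obtain i j where ij: "i \<in> {1..p}" "S = B i" "j \<in> {1..p}" "T = B j"
        using ST(1,2) \<B> by blast
      have "?\<phi> g \<in> AGL1 p B"
        using Gbar_affine g by (auto simp: Gbar car)
      moreover have "?\<phi> g (B i) = B i" "?\<phi> g (B j) = B j" "i \<noteq> j"
        using ij ST g by (auto simp: induced_perm_eq)
      ultimately have "?\<phi> g (B k) = B k" if "k \<in> {1..p}" for k
        using AGL1_two_fixed[OF _ eq(1) p(1) ij(1) _ ij(3) _ _ that] by blast
      then have "g ` Q = Q" if "Q \<in> \<B>" for Q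
        using that induced_perm_eq[OF g that] by (auto simp: \<B>)
      then show ?thesis
        using g by (simp add: block_kernel_def)
    qed
    show "b ` B 1 = B 1"
      using induced_perm_eq[OF b_car B1] b(2) \<beta>(2) by simp
  qed (fact B1 N_normal b_car b(3) b_pow d(2) d_pos generated)+

  \<comment> \<open>The group G(a,b) is all of \<open>G\<close>: an element of \<open>N\<close> has
    image \<alpha>^i for some \<open>i\<close>, so it differs from a^i by an element of
    \<open>K\<close>, and \<open>N\<close> together with \<open>b\<close> generates
    \<open>G\<close>.\<close>
  have "generate (BijGroup \<Omega>) (K \<union> {a, b}) = G"
  proof
    let ?H = "generate (BijGroup \<Omega>) (K \<union> {a, b})"
    have sub: "K \<union> {a, b} \<subseteq> G"
      using a(1) b(1) K_carrier by (auto simp: K_eq car)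
    then show "?H \<subseteq> G"
      using group.generate_subgroup_incl[OF group_BijGroup _ G_sub] by blast
    moreover have "subgroup ?H (BijGroup \<Omega>)"
      using sub subgroup.subset[OF G_sub] by (intro group.generate_is_subgroup[OF group_BijGroup]) blast
    ultimately have H: "subgroup ?H \<Gamma>"
      unfolding \<Gamma>_def using group.subgroup_incl[OF group_BijGroup] G_sub by blast
    show "G \<subseteq> ?H"
    proof
      fix g assume g: "g \<in> G"
      then obtain n j where n: "n \<in> N" "g = n \<otimes>\<^bsub>\<Gamma>\<^esub> b [^]\<^bsub>\<Gamma>\<^esub> (j::int)"
        using generated car by blast
      have nc: "n \<in> carrier \<Gamma>" and ac: "a \<in> carrier \<Gamma>"
        using n(1) a(1) by (simp_all add: N_def car)
      obtain i :: int where i: "?\<phi> n = \<alpha> [^]\<^bsub>?\<Delta>\<^esub> i"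
        using n(1) \<Delta>.generate_pow[OF \<alpha>(1)] by (auto simp: N_def)
      have "?\<phi> (n \<otimes>\<^bsub>\<Gamma>\<^esub> inv\<^bsub>\<Gamma>\<^esub> (a [^]\<^bsub>\<Gamma>\<^esub> i)) = \<one>\<^bsub>?\<Delta>\<^esub>"
        using nc ac i induced.hom_int_pow[OF ac] a(2) \<alpha>(1) by simp
      then have "n \<otimes>\<^bsub>\<Gamma>\<^esub> inv\<^bsub>\<Gamma>\<^esub> (a [^]\<^bsub>\<Gamma>\<^esub> i) \<in> K"
        unfolding K_eq kernel_eq_block_kernel[symmetric] using nc ac by (simp add: kernel_def)
      then have k: "n \<otimes>\<^bsub>\<Gamma>\<^esub> inv\<^bsub>\<Gamma>\<^esub> (a [^]\<^bsub>\<Gamma>\<^esub> i) \<in> ?H"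
        by (blast intro: generate.incl)
      have "a [^]\<^bsub>\<Gamma>\<^esub> i \<in> ?H" "b [^]\<^bsub>\<Gamma>\<^esub> j \<in> ?H"
        by (rule subgroup_int_pow_closed[OF H generate.incl], simp)+
      with k have "n \<otimes>\<^bsub>\<Gamma>\<^esub> inv\<^bsub>\<Gamma>\<^esub> (a [^]\<^bsub>\<Gamma>\<^esub> i) \<otimes>\<^bsub>\<Gamma>\<^esub> a [^]\<^bsub>\<Gamma>\<^esub> i \<otimes>\<^bsub>\<Gamma>\<^esub> b [^]\<^bsub>\<Gamma>\<^esub> j \<in> ?H"
        using subgroup.m_closed[OF H] by blast
      then show "g \<in> ?H"
        using n(2) nc ac by (simp add: m_assoc)
    qed
  qed
  then have density_eq:
    "intersection_density \<Omega> (generate (BijGroup \<Omega>) (K \<union> {a, b})) \<omega> = max 1 (6 / real d)"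
    if "\<omega> \<in> \<Omega>" for \<omega>
    using density[OF that] by (simp add: car)
  moreover have "max 1 (6 / real d) \<in> {1, 3 / 2, 3}" if "d \<le> 6"
  proof -
    \<comment> \<open>These three orders give the densities 3, 3/2 and 1.\<close>
    have "d = 2 \<or> d = 4 \<or> d = 6"
      using that \<open>even d\<close> d_pos by presburger
    then show ?thesis
      by auto
  qed
  ultimately show ?thesis
    by simp
qed

end
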